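(* Let $R:\overline{\mathbb{C}}\to\overline{\mathbb{C}}$ be a generic rational function all of whose critical points lie in $\overline{\mathbb{R}}=\mathbb{R}\cup\{\infty\}$. Then $R$ is equivalent to a real rational function; that is, there exists $\sigma\in\mathrm{Aut}(\overline{\mathbb{C}})$ such that $\sigma\circ R$ is a quotient of two polynomials with real coefficients.
   Context: A rational function of degree $d$ is generic if it has the maximal number $2d-2$ of distinct critical points (equivalently, all its critical points have local degree 2). Two rational functions $f,g$ of the same degree are equivalent if $f=\sigma\circ g$ for some Möbius transformation $\sigma\in\mathrm{Aut}(\overline{\mathbb{C}})$. *)

theory Defs
  imports Complex_Main "HOL-Computational_Algebra.Polynomial"
begin

(* The Riemann sphere; None is the point at infinity. *)
type_synonym sphere = "complex option"

definition real_circle :: "sphere set" where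
  "real_circle = insert None (Some ` \<real>)"

(* The self-map P/Q of the sphere, meaningful only for coprime P and Q.  The value at infinity is
   read off the coefficients of degree max (degree P) (degree Q), which do not both vanish. *)
fun ratio_map :: "complex poly \<Rightarrow> complex poly \<Rightarrow> sphere \<Rightarrow> sphere" where
  "ratio_map P Q (Some z) = (if poly Q z = 0 then None else Some (poly P z / poly Q z))"
| "ratio_map P Q None =
     (let n = max (degree P) (degree Q)
      in if coeff Q n = 0 then None else Some (coeff P n / coeff Q n))"

definition rational_map :: "nat \<Rightarrow> (sphere \<Rightarrow> sphere) \<Rightarrow> bool" where
  "rational_map d f \<longleftrightarrow>
     (\<exists>P Q. Q \<noteq> 0 \<and> coprime P Q \<and> d = max (degree P) (degree Q) \<and> f = ratio_map P Q)"

definition real_rational_map :: "(sphere \<Rightarrow> sphere) \<Rightarrow> bool" where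
  "real_rational_map f \<longleftrightarrow>
     (\<exists>P Q :: real poly. Q \<noteq> 0 \<and> coprime P Q \<and>
        f = ratio_map (map_poly complex_of_real P) (map_poly complex_of_real Q))"

(* z \<mapsto> (a z + b) / (c z + d) *)
definition moebius :: "(sphere \<Rightarrow> sphere) \<Rightarrow> bool" where
  "moebius \<sigma> \<longleftrightarrow> (\<exists>a b c d. a * d - b * c \<noteq> 0 \<and> \<sigma> = ratio_map [:b, a:] [:d, c:])"

(* Local parametrization of the sphere sending 0 to the given point:
   h \<mapsto> a + h at a finite point a, and h \<mapsto> 1/h at infinity. *)
fun local_param :: "sphere \<Rightarrow> complex \<Rightarrow> sphere" where
  "local_param (Some a) h = Some (a + h)"
| "local_param None h = (if h = 0 then None else Some (1 / h))"

(* Local coordinate near the point given first: w near a finite point, 1/w near infinity.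
   The value 0 at None in the first case is junk outside the chart domain, as is the value
   1/0 = 0 at Some 0 in the second; neither matters for germs of continuous maps. *)
fun local_coord :: "sphere \<Rightarrow> sphere \<Rightarrow> complex" where
  "local_coord (Some a) y = (case y of None \<Rightarrow> 0 | Some w \<Rightarrow> w)"
| "local_coord None y = (case y of None \<Rightarrow> 0 | Some w \<Rightarrow> 1 / w)"

definition critical_points :: "(sphere \<Rightarrow> sphere) \<Rightarrow> sphere set" where
  "critical_points f =
     {x. ((\<lambda>h. local_coord (f x) (f (local_param x h))) has_field_derivative 0) (at 0)}"

(* The equation is over the integers, so that degree 0 (where 2 d - 2 < 0) is excluded. *)
definition generic_rational_map :: "nat \<Rightarrow> (sphere \<Rightarrow> sphere) \<Rightarrow> bool" where
  "generic_rational_map d f \<longleftrightarrow>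
     rational_map d f \<and> finite (critical_points f) \<and>
     int (card (critical_points f)) = 2 * int d - 2"

end

theory Submission
  imports Defs "Jordan_Normal_Form.Determinant"
begin

text \<open>
  Write \<open>R = P / Q\<close>, let \<open>V\<close> be the span of \<open>P\<close> and \<open>Q\<close> and move a suitable real point to infinity, so that
  the critical points are the \<open>2 k = 2 d - 2\<close> distinct real roots of the Wronskian of \<open>V\<close> and the element
  \<open>y\<close> of least degree in \<open>V\<close>, which has degree \<open>k\<close>, vanishes at none of them.  It suffices that the
  numbers \<open>c x = y' x / y x\<close> are real at the critical points \<open>x\<close>: then the Wronskian of \<open>y\<close> and its
  complex conjugate vanishes at \<open>2 k\<close> points and has degree less than \<open>2 k\<close>, so \<open>y\<close> is real up to a
  factor, and \<open>V\<close> is recovered from \<open>y\<close> and the (real) Wronskian.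

  The numbers \<open>- c x\<close> are real because they are eigenvalues of the Gaudin Hamiltonians
  \<open>\<Sum>j \<noteq> x. (P\<^sub>x\<^sub>j - 1) / (x - j)\<close>, where \<open>P\<^sub>x\<^sub>j\<close> swaps two critical points; these operators act on
  functions on the \<open>k\<close>-element sets of critical points, and they are symmetric and real.  The eigenvector is explicit: with
  \<open>L x q = c x * q x - q' x\<close>, its value at \<open>{x\<^sub>1, \<dots>, x\<^sub>k}\<close> is the quotient of the determinants of
  \<open>L x\<^sub>a (u ^ b)\<close> and of \<open>x\<^sub>a ^ b\<close>.  It is nonzero, for otherwise some \<open>q \<noteq> 0\<close> of degree less than \<open>k\<close>
  would satisfy \<open>L x q = 0\<close> at all critical points, which makes \<open>q\<close> proportional to \<open>y\<close>.
\<close>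

section \<open>Wronskians and polynomials with given roots\<close>

hide_const (open) Module.smult

definition wronskian :: "'a::idom poly \<Rightarrow> 'a poly \<Rightarrow> 'a poly" where
  "wronskian p q = pderiv p * q - p * pderiv q"

lemma wronskian_add_left: "wronskian (p + q) r = wronskian p r + wronskian q r"
  by (simp add: wronskian_def pderiv_add algebra_simps)

lemma wronskian_diff_left: "wronskian (p - q) r = wronskian p r - wronskian q r"
  by (simp add: wronskian_def pderiv_diff algebra_simps)

lemma wronskian_smult_left: "wronskian (smult a p) q = smult a (wronskian p q)"
  by (simp add: wronskian_def pderiv_smult algebra_simps smult_diff_right)

lemma wronskian_smult_right: "wronskian p (smult a q) = smult a (wronskian p q)"
  by (simp add: wronskian_def pderiv_smult algebra_simps smult_diff_right)

lemma wronskian_swap: "wronskian q p = - wronskian p q"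
  by (simp add: wronskian_def algebra_simps)

lemma wronskian_self [simp]: "wronskian p p = 0"
  by (simp add: wronskian_def algebra_simps)

lemma wronskian_0_left [simp]: "wronskian 0 q = 0"
  by (simp add: wronskian_def)

text \<open>The Wronskian is bilinear and alternating, so a change of basis only multiplies it by
  the determinant; its roots belong to the span.\<close>

lemma wronskian_combination:
  "wronskian (smult a p + smult b q) (smult c p + smult e q) = smult (a * e - b * c) (wronskian p q)"
proof -
  have "wronskian (smult a p + smult b q) (smult c p + smult e q)
    = smult a (smult e (wronskian p q)) - smult b (smult c (wronskian p q))"
    unfolding wronskian_def pderiv_add pderiv_smult
    by (simp add: algebra_simps smult_add_right smult_diff_right)
  then show ?thesis by (simp add: smult_diff_left)
qed

lemma coeff_mult_top:
  fixes p q :: "'a::comm_semiring_0 poly"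
  assumes "degree p \<le> m" "degree q \<le> n"
  shows "coeff (p * q) (m + n) = coeff p m * coeff q n"
proof (cases "degree p = m \<and> degree q = n")
  case True
  then show ?thesis using coeff_mult_degree_sum[of p q] by simp
next
  case False
  then have *: "degree p + degree q < m + n" using assms by linarith
  then have "degree (p * q) < m + n" using degree_mult_le[of p q] by linarith
  then have "coeff (p * q) (m + n) = 0" by (rule coeff_eq_0)
  moreover have "coeff p m * coeff q n = 0"
    using False assms by (metis coeff_eq_0 le_neq_implies_less mult_zero_left mult_zero_right)
  ultimately show ?thesis by simp
qed

lemma pderiv_eq_0_of_degree: "degree p = 0 \<Longrightarrow> pderiv p = 0"
  by (metis degree_eq_zeroE pderiv_singleton)

text \<open>Here \<open>m\<close> and \<open>n\<close> are only upper bounds. For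
  \<open>m = n\<close> the two contributions cancel, which lowers the degree bound
  \<open>2 * d - 1\<close> to \<open>2 * d - 2\<close>.\<close>

lemma coeff_wronskian_top:
  fixes p q :: "'a::idom poly"
  assumes "degree p \<le> m" "degree q \<le> n"
  shows "coeff (wronskian p q) (m + n - 1) = (of_nat m - of_nat n) * (coeff p m * coeff q n)"
proof -
  have a: "coeff (pderiv p * q) (m + n - 1) = of_nat m * (coeff p m * coeff q n)"
  proof (cases m)
    case 0
    then have "pderiv p = 0" using assms by (simp add: pderiv_eq_0_of_degree)
    then show ?thesis using 0 by simp
  next
    case (Suc m')
    have "degree (pderiv p) \<le> m'"
      using assms Suc by (intro degree_le) (auto simp: coeff_pderiv coeff_eq_0)
    from coeff_mult_top[OF this assms(2)] Suc show ?thesis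
      by (simp add: coeff_pderiv algebra_simps)
  qed
  have b: "coeff (p * pderiv q) (m + n - 1) = of_nat n * (coeff p m * coeff q n)"
  proof (cases n)
    case 0
    then have "pderiv q = 0" using assms by (simp add: pderiv_eq_0_of_degree)
    then show ?thesis using 0 by simp
  next
    case (Suc n')
    have "degree (pderiv q) \<le> n'"
      using assms Suc by (intro degree_le) (auto simp: coeff_pderiv coeff_eq_0)
    from coeff_mult_top[OF assms(1) this] Suc show ?thesis
      by (simp add: coeff_pderiv algebra_simps)
  qed
  show ?thesis by (simp only: wronskian_def coeff_diff a b left_diff_distrib)
qed

lemma degree_wronskian_le:
  fixes p q :: "'a::idom poly"
  assumes "degree p \<le> m" "degree q \<le> n"
  shows "degree (wronskian p q) \<le> m + n - 1"
proof -
  have bound: "degree (pderiv a * b) \<le> r + s - 1" if "degree a \<le> r" "degree b \<le> s"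
    for a b :: "'a poly" and r s
  proof (cases "degree a = 0")
    case True
    then have "pderiv a = 0" by (rule pderiv_eq_0_of_degree)
    then show ?thesis by simp
  next
    case False
    have "degree (pderiv a) \<le> degree a - 1"
      by (intro degree_le) (auto simp: coeff_pderiv coeff_eq_0)
    then show ?thesis using False that degree_mult_le[of "pderiv a" b] by linarith
  qed
  show ?thesis unfolding wronskian_def
    using bound[OF assms] bound[OF assms(2,1)]
    by (intro degree_diff_le) (simp_all add: mult.commute add.commute)
qed

lemma wronskian_eq_0_imp_degree_eq:
  fixes p q :: "'a::{idom,ring_char_0} poly"
  assumes "wronskian p q = 0" "p \<noteq> 0" "q \<noteq> 0"
  shows "degree p = degree q"
  using coeff_wronskian_top[of p "degree p" q "degree q"] assms by simp

text \<open>Subtracting the multiple of \<open>q\<close> that kills the coefficient at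
  \<open>degree q\<close> keeps the Wronskian zero; a nonzero remainder would need exactly that
  degree.\<close>

lemma wronskian_eq_0_imp_smult:
  fixes p q :: "'a::field_char_0 poly"
  assumes "wronskian p q = 0" "q \<noteq> 0"
  obtains c where "p = smult c q"
proof -
  define c where "c = coeff p (degree q) / lead_coeff q"
  have w: "wronskian (p - smult c q) q = 0"
    using assms by (simp add: wronskian_diff_left wronskian_smult_left)
  have "p - smult c q = 0"
  proof (rule ccontr)
    assume nz: "p - smult c q \<noteq> 0"
    have "degree (p - smult c q) = degree q"
      using wronskian_eq_0_imp_degree_eq[OF w nz assms(2)] .
    moreover have "coeff (p - smult c q) (degree q) = 0"
      using assms(2) by (simp add: c_def)
    ultimately show False using nz by (metis leading_coeff_0_iff)
  qed
  then show thesis using that[of c] by simp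
qed

section \<open>Root counting, monic polynomials with given roots, Lagrange interpolation\<close>

lemma poly_eq_0_of_many_roots:
  fixes p :: "'a::idom poly"
  assumes "\<And>x. x \<in> A \<Longrightarrow> poly p x = 0" "finite A" "p \<noteq> 0 \<Longrightarrow> degree p < card A"
  shows "p = 0"
proof (rule ccontr)
  assume nz: "p \<noteq> 0"
  have "card A \<le> card {x. poly p x = 0}"
    using nz assms(1) by (intro card_mono poly_roots_finite) auto
  also have "\<dots> \<le> degree p" by (rule card_poly_roots_bound[OF nz])
  finally show False using assms(3) nz by simp
qed

definition root_poly :: "'a::comm_ring_1 set \<Rightarrow> 'a poly" where
  "root_poly A = (\<Prod>a\<in>A. [:- a, 1:])"

lemma poly_root_poly: "poly (root_poly A) x = (\<Prod>a\<in>A. x - a)"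
  by (simp add: root_poly_def poly_prod)

lemma poly_root_poly_eq_0:
  fixes A :: "'a::idom set"
  assumes "finite A" shows "poly (root_poly A) x = 0 \<longleftrightarrow> x \<in> A"
  using assms by (auto simp: poly_root_poly)

lemma monic_root_poly: "lead_coeff (root_poly A) = (1::'a::idom)"
  unfolding root_poly_def lead_coeff_prod by simp

lemma root_poly_nonzero [simp]: "root_poly A \<noteq> (0::'a::idom poly)"
  using monic_root_poly[of A] by auto

lemma degree_root_poly [simp]: "degree (root_poly (A::'a::idom set)) = card A"
  unfolding root_poly_def by (subst degree_prod_sum_eq) auto

lemma root_poly_Un: "finite A \<Longrightarrow> finite B \<Longrightarrow> A \<inter> B = {} \<Longrightarrow>
   root_poly (A \<union> B) = root_poly A * root_poly B"
  by (simp add: root_poly_def prod.union_disjoint)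

lemma root_poly_insert: "finite A \<Longrightarrow> a \<notin> A \<Longrightarrow> root_poly (insert a A) = [:-a, 1:] * root_poly A"
  by (simp add: root_poly_def)

lemma poly_pderiv_root_poly_insert:
  assumes "finite A" "a \<notin> A"
  shows "poly (pderiv (root_poly (insert a A))) a = poly (root_poly A) a"
  unfolding root_poly_insert[OF assms] pderiv_mult by (simp add: pderiv_pCons)

lemma poly_pderiv2_root_poly_insert:
  assumes "finite A" "a \<notin> A"
  shows "poly (pderiv (pderiv (root_poly (insert a A)))) a = 2 * poly (pderiv (root_poly A)) a"
  unfolding root_poly_insert[OF assms] pderiv_mult pderiv_add by (simp add: pderiv_pCons)

lemma poly_pderiv_root_poly_in:
  assumes "finite A" "j \<in> A"
  shows "poly (pderiv (root_poly A)) j = poly (root_poly (A - {j})) j"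
  using poly_pderiv_root_poly_insert[of "A - {j}" j] assms by (simp add: insert_absorb)

lemma root_poly_dvd:
  fixes p :: "'a::idom poly"
  assumes "finite A" "\<And>a. a \<in> A \<Longrightarrow> poly p a = 0"
  shows "root_poly A dvd p"
  using assms
proof (induction A)
  case empty
  then show ?case by (simp add: root_poly_def)
next
  case (insert a A)
  then obtain g where g: "p = root_poly A * g" by auto
  have "poly p a = 0" using insert by auto
  then have "poly g a = 0" using insert poly_root_poly_eq_0[of A a] by (simp add: g)
  then obtain h where "g = [:-a, 1:] * h" using poly_eq_0_iff_dvd by blast
  then have "p = root_poly (insert a A) * h"
    unfolding g root_poly_insert[OF insert(1,2)] by (simp only: mult_ac)
  then show ?case by simp
qed

text \<open>Partial fractions of \<open>e / root_poly S\<close> at \<open>i\<close>: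
  \<open>e\<close> equals its Lagrange interpolant at the nodes \<open>S\<close>. The guard
  \<open>e \<noteq> 0\<close> admits \<open>e = 0\<close> with \<open>S\<close> empty.\<close>

lemma lagrange_outside:
  fixes e :: "'a::field poly"
  assumes fin: "finite S" and deg: "e \<noteq> 0 \<Longrightarrow> degree e < card S" and i: "i \<notin> S"
  shows "(\<Sum>j\<in>S. poly e j / (poly (pderiv (root_poly S)) j * (i - j)))
         = poly e i / poly (root_poly S) i"
proof -
  define D where "D j = poly (root_poly (S - {j})) j" for j
  have D0: "D j \<noteq> 0" if "j \<in> S" for j
    using fin by (simp add: D_def poly_root_poly_eq_0)
  define L where "L = (\<Sum>j\<in>S. smult (poly e j / D j) (root_poly (S - {j})))"
  have "e - L = 0"
  proof (rule poly_eq_0_of_many_roots[OF _ fin])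
    fix x assume x: "x \<in> S"
    have "poly L x = (\<Sum>j\<in>S. poly e j / D j * poly (root_poly (S - {j})) x)"
      by (simp add: L_def poly_sum)
    also have "\<dots> = (\<Sum>j\<in>S. if j = x then poly e x else 0)"
      using fin x D0 by (intro sum.cong) (auto simp: D_def poly_root_poly_eq_0)
    also have "\<dots> = poly e x" using fin x by simp
    finally show "poly (e - L) x = 0" by simp
  next
    assume nz: "e - L \<noteq> 0"
    then have S: "card S > 0" using fin deg by (auto simp: L_def card_gt_0_iff)
    have "degree L \<le> card S - 1" unfolding L_def
      using fin by (intro degree_sum_le) (auto intro: order.trans[OF degree_smult_le])
    moreover have "degree e \<le> card S - 1" using S deg by (cases "e = 0") auto
    ultimately have "degree (e - L) \<le> card S - 1" by (rule degree_diff_le[rotated])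
    then show "degree (e - L) < card S" using S by simp
  qed
  then have "poly e i = poly L i" by simp
  also have "\<dots> = (\<Sum>j\<in>S. poly e j / D j * (poly (root_poly S) i / (i - j)))"
  proof -
    have "poly (root_poly (S - {j})) i = poly (root_poly S) i / (i - j)" if "j \<in> S" for j
    proof -
      have "i \<noteq> j" using that i by auto
      have e: "root_poly S = [:- j, 1:] * root_poly (S - {j})"
        using fin that root_poly_insert[of "S - {j}" j] by (simp add: insert_absorb)
      have "poly (root_poly S) i = (i - j) * poly (root_poly (S - {j})) i"
        by (subst e) (simp add: algebra_simps)
      with \<open>i \<noteq> j\<close> show ?thesis by simp
    qed
    then show ?thesis by (simp add: L_def poly_sum)
  qed
  also have "\<dots> = poly (root_poly S) i *
      (\<Sum>j\<in>S. poly e j / (poly (pderiv (root_poly S)) j * (i - j)))"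
    using fin by (auto simp: sum_distrib_left D_def poly_pderiv_root_poly_in intro!: sum.cong)
  finally show ?thesis using i fin by (simp add: poly_root_poly_eq_0)
qed

section \<open>Determinants of linear functionals on polynomials\<close>

text \<open>Evaluation functionals give the Vandermonde determinant, so the same expansion lemmas
  serve the numerator and the denominator of the eigenvector.\<close>

definition functional_det :: "('b \<Rightarrow> 'a::field poly \<Rightarrow> 'a) \<Rightarrow> 'b list \<Rightarrow> 'a" where
  "functional_det L xs = det (mat (length xs) (length xs) (\<lambda>(a, b). L (xs ! a) (monom 1 b)))"

locale poly_functionals =
  fixes L :: "'b \<Rightarrow> 'a::field poly \<Rightarrow> 'a"
  assumes add: "L x (p + q) = L x p + L x q"
    and smult: "L x (smult c p) = c * L x p"
begin

lemma zero [simp]: "L x 0 = 0"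
  using smult[of x 0 0] by simp

lemma diff: "L x (p - q) = L x p - L x q"
  using add[of x p "smult (-1) q"] smult[of x "-1" q] by simp

lemma sum: "L x (\<Sum>i\<in>I. f i) = (\<Sum>i\<in>I. L x (f i))"
  by (induction I rule: infinite_finite_induct) (simp_all add: add)

lemma expand:
  assumes "\<And>b. b \<ge> k \<Longrightarrow> coeff r b = 0"
  shows "L x r = (\<Sum>b<k. coeff r b * L x (monom 1 b))"
proof -
  have "r = (\<Sum>b<k. smult (coeff r b) (monom 1 b))"
    using assms by (intro poly_eqI) (auto simp: coeff_sum if_distrib not_less cong: if_cong)
  then have "L x r = L x (\<Sum>b<k. smult (coeff r b) (monom 1 b))" by simp
  then show ?thesis by (simp only: sum smult)
qed

abbreviation D where "D \<equiv> functional_det L"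

abbreviation M where
  "M xs \<equiv> mat (length xs) (length xs) (\<lambda>(a, b). L (xs ! a) (monom 1 b))"

lemma cofactor_update:
  assumes "a < length xs" "b < length xs"
  shows "cofactor (M (xs[a := x])) a b = cofactor (M xs) a b"
proof -
  have "mat_delete (M (xs[a := x])) a b = mat_delete (M xs) a b"
    using assms by (intro eq_matI) (auto simp: mat_delete_def nth_list_update)
  then show ?thesis by (simp add: cofactor_def)
qed

lemma det_update:
  assumes "a < length xs"
  shows "D (xs[a := x]) = (\<Sum>b<length xs. L x (monom 1 b) * cofactor (M xs) a b)"
proof -
  have "D (xs[a := x]) = (\<Sum>b<length xs. M (xs[a := x]) $$ (a, b) * cofactor (M (xs[a := x])) a b)"
    unfolding functional_det_def using assms by (intro laplace_expansion_row) auto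
  also have "\<dots> = (\<Sum>b<length xs. L x (monom 1 b) * cofactor (M xs) a b)"
    using assms by (intro sum.cong refl arg_cong2[where f = "(*)"] cofactor_update) auto
  finally show ?thesis .
qed

text \<open>In the Laplace expansion along row \<open>a\<close> the cofactors do not involve
  \<open>x\<close>, so they are the coefficients of one polynomial \<open>q\<close>.\<close>

lemma det_update_poly:
  assumes "a < length xs"
  obtains q where "\<And>x. D (xs[a := x]) = L x q" "degree q < length xs"
    "coeff q (length xs - 1) = cofactor (M xs) a (length xs - 1)"
proof -
  define q where "q = (\<Sum>b<length xs. monom (cofactor (M xs) a b) b)"
  have c: "coeff q b = (if b < length xs then cofactor (M xs) a b else 0)" for b
    by (simp add: q_def coeff_sum)
  show thesis
  proof
    show "D (xs[a := x]) = L x q" for x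
      using c by (subst expand[of "length xs"]) (auto simp: det_update[OF assms] mult.commute)
    have "degree q \<le> length xs - 1"
      using c by (intro degree_le) auto
    then show "degree q < length xs" using assms by simp
    show "coeff q (length xs - 1) = cofactor (M xs) a (length xs - 1)"
      using assms c[of "length xs - 1"] by simp
  qed
qed

lemma det_update_duplicate:
  assumes "a < length xs" "b < length xs" "a \<noteq> b"
  shows "D (xs[a := xs ! b]) = 0"
  unfolding functional_det_def
proof (rule det_identical_rows[OF _ assms(3)])
  show "row (M (xs[a := xs ! b])) a = row (M (xs[a := xs ! b])) b"
    using assms by (intro eq_vecI) auto
qed (use assms in auto)

lemma det_snoc_poly:
  obtains q where "\<And>x. D (xs @ [x]) = L x q" "degree q \<le> length xs" "coeff q (length xs) = D xs"
proof -
  \<comment> \<open>The placeholder is overwritten by each update of the last position; deleting its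
    row and the last column leaves \<open>M xs\<close>.\<close>
  let ?ys = "xs @ [undefined]"
  obtain q where q: "\<And>x. D (?ys[length xs := x]) = L x q" "degree q < length ?ys"
    "coeff q (length ?ys - 1) = cofactor (M ?ys) (length xs) (length ?ys - 1)"
    using det_update_poly[of "length xs" ?ys] by auto
  have "mat_delete (M ?ys) (length xs) (length xs) = M xs"
    by (intro eq_matI) (auto simp: mat_delete_def nth_append)
  then have "coeff q (length xs) = D xs"
    using q(3) by (simp add: cofactor_def functional_det_def flip: mult_2)
  then show thesis using q that[of q] by simp
qed

lemma det_swap:
  assumes ij: "i \<in> set xs" "j \<in> set xs" "i \<noteq> j" and "distinct xs"
  shows "D (map (transpose i j) xs) = - D xs"
proof -
  obtain a b where ab: "a < length xs" "b < length xs" "xs ! a = i" "xs ! b = j"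
    using ij by (metis in_set_conv_nth)
  with ij have "a \<noteq> b" by auto
  have "M (map (transpose i j) xs) = swaprows a b (M xs)"
    using ab \<open>distinct xs\<close>
    by (intro eq_matI) (auto simp: transpose_def nth_eq_iff_index_eq)
  then show ?thesis unfolding functional_det_def
    using det_swaprows[of a "length xs" b "M xs"] ab \<open>a \<noteq> b\<close> by simp
qed

text \<open>By \<open>det_update\<close> the numbers \<open>D (xs[a := x])\<close> form the row of
  \<open>L x\<close> times the adjugate of \<open>M xs\<close>, and the adjugate times
  \<open>M xs\<close> is \<open>D xs\<close> times the identity.\<close>

lemma cramer:
  assumes "degree r < length xs"
  shows "(\<Sum>a<length xs. L (xs ! a) r * D (xs[a := x])) = L x r * D xs"
proof -
  let ?k = "length xs"
  have ex: "L x r = (\<Sum>b<?k. coeff r b * L x (monom 1 b))" for x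
    using assms by (intro expand coeff_eq_0) simp
  have adj: "(\<Sum>a<?k. cofactor (M xs) a b * L (xs ! a) (monom 1 c)) = (if b = c then D xs else 0)"
    if "b < ?k" "c < ?k" for b c
  proof -
    have "(adj_mat (M xs) * M xs) $$ (b, c) = (D xs \<cdot>\<^sub>m 1\<^sub>m ?k) $$ (b, c)"
      unfolding functional_det_def by (subst adj_mat(3)[of _ ?k]) auto
    then show ?thesis using that
      by (simp add: adj_mat_def scalar_prod_def lessThan_atLeast0)
  qed
  have "(\<Sum>a<?k. L (xs ! a) r * D (xs[a := x]))
    = (\<Sum>a<?k. \<Sum>b<?k. \<Sum>c<?k. L x (monom 1 b) * coeff r c * (cofactor (M xs) a b * L (xs ! a) (monom 1 c)))"
    by (intro sum.cong refl)
      (simp add: det_update ex[of "xs ! _"] sum_product sum_distrib_left sum_distrib_right mult_ac)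
  also have "\<dots> = (\<Sum>b<?k. \<Sum>c<?k. \<Sum>a<?k. L x (monom 1 b) * coeff r c * (cofactor (M xs) a b * L (xs ! a) (monom 1 c)))"
    by (rule trans[OF sum.swap], rule sum.cong[OF refl], rule sum.swap)
  also have "\<dots> = (\<Sum>b<?k. \<Sum>c<?k. L x (monom 1 b) * coeff r c * (if b = c then D xs else 0))"
    by (intro sum.cong refl) (simp add: adj flip: sum_distrib_left)
  also have "\<dots> = (\<Sum>b<?k. L x (monom 1 b) * coeff r b * D xs)"
    by (intro sum.cong refl) (simp add: if_distrib cong: if_cong)
  also have "\<dots> = L x r * D xs"
    unfolding ex[of x] sum_distrib_right by (intro sum.cong refl) (simp only: mult_ac)
  finally show ?thesis .
qed

text \<open>As a function of the new entry the determinant is \<open>L x q\<close>, where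
  \<open>q\<close> has coefficient \<open>D xs\<close> at \<open>length xs\<close> and so is
  nonzero; a repeated entry would give two equal rows.\<close>

lemma det_nonzero_extend:
  assumes "D xs \<noteq> 0"
    and inj: "\<And>q. \<forall>x\<in>X. L x q = 0 \<Longrightarrow> degree q \<le> length xs \<Longrightarrow> q = 0"
  obtains x where "x \<in> X" "x \<notin> set xs" "D (xs @ [x]) \<noteq> 0"
proof -
  obtain q where q: "\<And>x. D (xs @ [x]) = L x q" "degree q \<le> length xs" "coeff q (length xs) = D xs"
    using det_snoc_poly by blast
  from q(3) assms(1) have "q \<noteq> 0" by auto
  with inj q(2) obtain x where x: "x \<in> X" "L x q \<noteq> 0" by blast
  have "D (xs @ [x]) = 0" if "x \<in> set xs"
  proof -
    from that obtain b where "b < length xs" "xs ! b = x" by (metis in_set_conv_nth)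
    then show ?thesis
      using det_update_duplicate[of "length xs" "xs @ [undefined]" b] by (simp add: nth_append)
  qed
  with x q(1) that show thesis by metis
qed

lemma exists_nonzero_det:
  assumes "\<And>q. \<forall>x\<in>X. L x q = 0 \<Longrightarrow> degree q < k \<Longrightarrow> q = 0"
  shows "\<exists>xs. length xs = k \<and> distinct xs \<and> set xs \<subseteq> X \<and> D xs \<noteq> 0"
  using assms
proof (induction k)
  case 0
  show ?case by (intro exI[of _ "[]"]) (simp add: functional_det_def det_def)
next
  case (Suc k)
  obtain xs where xs: "length xs = k" "distinct xs" "set xs \<subseteq> X" "D xs \<noteq> 0"
    using Suc by force
  obtain x where "x \<in> X" "x \<notin> set xs" "D (xs @ [x]) \<noteq> 0"
    using det_nonzero_extend[OF xs(4), of X] Suc.prems xs(1) by (metis less_Suc_eq_le)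
  with xs show ?case by (intro exI[of _ "xs @ [x]"]) simp
qed

end

section \<open>Vandermonde determinants\<close>

interpretation evaluation: poly_functionals "\<lambda>x p. poly p x"
  by standard simp_all

abbreviation vandermonde :: "'a::field list \<Rightarrow> 'a" where
  "vandermonde \<equiv> functional_det (\<lambda>x p. poly p x)"

lemma vandermonde_nonzero:
  "distinct xs \<Longrightarrow> vandermonde xs \<noteq> 0"
proof (induction xs rule: rev_induct)
  case Nil
  show ?case by (simp add: functional_det_def det_def)
next
  case (snoc x xs)
  \<comment> \<open>A nonzero polynomial of degree at most \<open>length xs\<close> cannot vanish on
    all of \<open>xs @ [x]\<close>; the extending point lies outside \<open>xs\<close>, so it is
    \<open>x\<close>.\<close>
  obtain y where "y \<in> set (xs @ [x])" "y \<notin> set xs" "vandermonde (xs @ [y]) \<noteq> 0"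
  proof (rule evaluation.det_nonzero_extend[of xs "set (xs @ [x])"])
    show "q = 0" if "\<forall>y\<in>set (xs @ [x]). poly q y = 0" "degree q \<le> length xs" for q
      using that snoc.prems distinct_card[of "xs @ [x]"]
      by (intro poly_eq_0_of_many_roots[of "set (xs @ [x])"]) auto
  qed (use snoc in auto)
  then show ?case by auto
qed

text \<open>Both sides are polynomials in \<open>x\<close> of degree below \<open>length xs\<close>
  that vanish at the other entries and agree at \<open>xs ! a\<close>.\<close>

lemma vandermonde_update:
  assumes "distinct xs" "a < length xs"
  shows "vandermonde (xs[a := x]) * poly (root_poly (set xs - {xs ! a})) (xs ! a)
       = vandermonde xs * poly (root_poly (set xs - {xs ! a})) x"
proof -
  let ?v = "root_poly (set xs - {xs ! a})"
  obtain q where q: "\<And>x. vandermonde (xs[a := x]) = poly q x" "degree q < length xs"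
    using evaluation.det_update_poly[OF assms(2)] by blast
  have "card (set xs - {xs ! a}) = length xs - 1"
    using assms by (simp add: distinct_card)
  have "q * [:poly ?v (xs ! a):] - ?v * [:poly q (xs ! a):] = 0" (is "?d = 0")
  proof (rule poly_eq_0_of_many_roots)
    show "poly ?d y = 0" if y: "y \<in> set xs" for y
    proof (cases "y = xs ! a")
      case False
      obtain b where "b < length xs" "xs ! b = y" using y by (metis in_set_conv_nth)
      then have "poly q y = 0"
        using evaluation.det_update_duplicate[of a xs b] assms False q(1) by fastforce
      then show ?thesis using False y by (simp add: poly_root_poly_eq_0)
    qed (simp add: algebra_simps)
    have "degree ?v < length xs"
      using assms \<open>card (set xs - {xs ! a}) = _\<close> by simp
    have "degree (p * [:c:]) \<le> degree p" for p :: "'a poly" and c by simp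
    with q(2) \<open>degree ?v < _\<close> have "degree ?d < length xs"
      by (intro degree_diff_less) (meson le_less_trans)+
    then show "degree ?d < card (set xs)" using assms(1) by (simp add: distinct_card)
  qed simp
  then have "poly ?d x = 0" by simp
  then show ?thesis using q(1)[of x] q(1)[of "xs ! a"] by (simp add: algebra_simps)
qed

section \<open>The Gaudin eigenvector\<close>

text \<open>Logarithmic derivative of a product of linear factors.\<close>

lemma sum_inverse_diff_root_poly:
  fixes i :: "'a::field"
  assumes "finite A" "i \<notin> A"
  shows "(\<Sum>j\<in>A. 1 / (i - j)) = poly (pderiv (root_poly A)) i / poly (root_poly A) i"
  using assms
proof (induction A)
  case empty
  then show ?case by (simp add: root_poly_def)
next
  case (insert a A)
  then have "poly (root_poly A) i \<noteq> 0" "i - a \<noteq> 0" by (auto simp: poly_root_poly_eq_0)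
  moreover have "poly (root_poly (insert a A)) i = (i - a) * poly (root_poly A) i"
    "poly (pderiv (root_poly (insert a A))) i
      = (i - a) * poly (pderiv (root_poly A)) i + poly (root_poly A) i"
    by (simp_all only: root_poly_insert[OF insert(1,2)] pderiv_mult poly_add poly_mult)
      (simp_all add: pderiv_pCons)
  moreover have "(\<Sum>j\<in>insert a A. 1 / (i - j)) = 1 / (i - a)
      + poly (pderiv (root_poly A)) i / poly (root_poly A) i"
    using insert by simp
  ultimately show ?case by (simp add: add_divide_distrib)
qed

text \<open>Since \<open>y\<close> does not vanish at \<open>a\<close>, its cofactor must, so the
  linear factors cancel one at a time.\<close>

lemma dvd_mult_root_poly_cancel:
  fixes y :: "'a::idom poly"
  assumes "finite A" "\<And>a. a \<in> A \<Longrightarrow> poly y a \<noteq> 0" "y dvd root_poly A * p"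
  shows "y dvd p"
  using assms
proof (induction A arbitrary: p)
  case empty
  then show ?case by (simp add: root_poly_def)
next
  case (insert a A)
  have "y dvd root_poly A * ([:-a, 1:] * p)"
    using insert.prems(2) by (simp only: root_poly_insert[OF insert(1,2)] mult_ac)
  then have "y dvd [:-a, 1:] * p" using insert by blast
  then obtain t where t: "[:-a, 1:] * p = y * t" by auto
  have "poly (y * t) a = 0" by (simp flip: t)
  then have "poly t a = 0" using insert.prems(1) by auto
  then obtain t' where "t = [:-a, 1:] * t'" using poly_eq_0_iff_dvd by blast
  then have "[:-a, 1:] * p = [:-a, 1:] * (y * t')" using t by (simp only: mult_ac)
  then have "p = y * t'" by (metis mult_left_cancel pCons_eq_0_iff one_neq_zero)
  then show ?case by simp
qed

lemma map_transpose_eq_update: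
  assumes "distinct xs" "a < length xs" "j \<notin> set xs"
  shows "map (transpose (xs ! a) j) xs = xs[a := j]"
  using assms by (intro nth_equalityI) (auto simp: nth_list_update transpose_def nth_eq_iff_index_eq)

lemma map_transpose_id: "i \<notin> set xs \<Longrightarrow> j \<notin> set xs \<Longrightarrow> map (transpose i j) xs = xs"
  by (rule map_idI) (auto simp: transpose_def)

lemma map_transpose_map_transpose [simp]: "map (transpose i j) (map (transpose i j) xs) = xs"
  by (simp add: o_def)

text \<open>The assumption \<open>bethe\<close> says that \<open>y\<close> solves \<open>W y'' - W' y' + U y = 0\<close> for a polynomial \<open>U\<close>, where
  \<open>W = root_poly X\<close>; for simple roots \<open>t\<close> of \<open>y\<close> these are the Bethe equations.\<close>

locale gaudin =
  fixes y :: "complex poly" and X :: "complex set" and k :: nat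
  assumes fin: "finite X"
    and card_X: "card X = 2 * k"
    and y_nonzero: "y \<noteq> 0"
    and deg_y: "degree y = k"
    and nonroot: "x \<in> X \<Longrightarrow> poly y x \<noteq> 0"
    and bethe: "y dvd root_poly X * pderiv (pderiv y) - pderiv (root_poly X) * pderiv y"
begin

definition c where "c x = poly (pderiv y) x / poly y x"

definition L where "L x q = c x * poly q x - poly (pderiv q) x"

sublocale poly_functionals L
  by standard (simp_all add: L_def pderiv_add pderiv_smult algebra_simps)

definition \<psi> where "\<psi> xs = D xs / vandermonde xs"

lemma L_eq_wronskian: "x \<in> X \<Longrightarrow> L x q = poly (wronskian y q) x / poly y x"
  using nonroot[of x] by (simp add: L_def c_def wronskian_def field_simps)

lemma L_y: "x \<in> X \<Longrightarrow> L x y = 0"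
  by (simp add: L_eq_wronskian)

text \<open>Numerator and denominator both change sign. Hence lists of distinct points can represent
  sets.\<close>

lemma \<psi>_swap:
  assumes "i \<in> set xs" "j \<in> set xs" "distinct xs"
  shows "\<psi> (map (transpose i j) xs) = \<psi> xs"
  using assms det_swap[of i xs j] evaluation.det_swap[of i xs j]
  by (cases "i = j") (simp_all add: \<psi>_def)

text \<open>Here only \<open>L x y = 0\<close> for all \<open>x \<in> X\<close> matters: it makes \<open>root_poly (set xs)\<close> equivalent to a
  polynomial of degree less than \<open>k\<close>, and Cramer's rule applies.\<close>

lemma hamiltonian_outside:
  assumes xs: "length xs = k" "distinct xs" "set xs \<subseteq> X" and i: "i \<in> X" "i \<notin> set xs"
  shows "(\<Sum>j\<in>set xs. (\<psi> (map (transpose i j) xs) - \<psi> xs) / (i - j)) = - c i * \<psi> xs"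
proof -
  define w where "w = root_poly (set xs)"
  define V where "V = vandermonde xs"
  have V: "V \<noteq> 0" using vandermonde_nonzero xs(2) by (simp add: V_def)
  have wi: "poly w i \<noteq> 0" using i by (simp add: w_def poly_root_poly_eq_0)
  \<comment> \<open>By \<open>vandermonde_update\<close> the swapped denominator is \<open>V\<close>
    times \<open>v\<close> at \<open>i\<close> over \<open>v\<close> at \<open>xs ! a\<close>; the
    factor \<open>i - xs ! a\<close> completes \<open>v\<close> to \<open>w\<close>.\<close>
  have \<psi>a: "\<psi> (map (transpose i (xs ! a)) xs) / (i - xs ! a)
      = poly (pderiv w) (xs ! a) * D (xs[a := i]) / (V * poly w i)" if a: "a < length xs" for a
  proof -
    define v where "v = root_poly (set xs - {xs ! a})"
    have w: "w = [:- (xs ! a), 1:] * v"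
      using root_poly_insert[of "set xs - {xs ! a}" "xs ! a"] a
      by (simp add: w_def v_def insert_absorb)
    have 1: "poly w i = (i - xs ! a) * poly v i"
      unfolding w by (simp add: algebra_simps)
    have 2: "poly (pderiv w) (xs ! a) = poly v (xs ! a)"
      unfolding w pderiv_mult by (simp add: pderiv_pCons)
    have 3: "vandermonde (xs[a := i]) * poly v (xs ! a) = V * poly v i"
      unfolding V_def v_def using vandermonde_update[OF xs(2) a] .
    have 4: "map (transpose i (xs ! a)) xs = xs[a := i]"
      using map_transpose_eq_update[OF xs(2) a i(2)] by (simp add: transpose_commute)
    have "poly v (xs ! a) \<noteq> 0" by (simp add: v_def poly_root_poly_eq_0)
    with 3 have 5: "vandermonde (xs[a := i]) = V * poly v i / poly v (xs ! a)"
      by (simp add: field_simps)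
    show ?thesis unfolding 4 \<psi>_def 1 2 5 by (simp add: mult_ac)
  qed
  define r where "r = w - smult (1 / lead_coeff y) y"
  have Lr: "L x r = L x w" if "x \<in> X" for x
    using L_y[OF that] by (simp add: r_def diff smult)
  have "card X \<noteq> 0" using i fin by auto
  then have "k \<noteq> 0" using card_X by simp
  have deg_w: "degree w = k" using xs by (simp add: w_def distinct_card)
  have "degree r < k"
  proof -
    have lead_y: "coeff y k \<noteq> 0" using y_nonzero deg_y leading_coeff_0_iff by metis
    have "coeff r k = 0"
      using monic_root_poly[of "set xs"] deg_w deg_y lead_y by (simp add: r_def w_def)
    moreover have "degree r \<le> k"
      unfolding r_def using deg_w deg_y by (intro degree_diff_le) (auto intro: order.trans[OF degree_smult_le])
    ultimately show ?thesis using \<open>k \<noteq> 0\<close>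
      by (metis degree_0 leading_coeff_0_iff le_neq_implies_less neq0_conv)
  qed
  then have cr: "(\<Sum>a<length xs. L (xs ! a) r * D (xs[a := i])) = L i r * D xs"
    using cramer[of r xs i] xs by simp
  have Lw: "L (xs ! a) r = - poly (pderiv w) (xs ! a)" if "a < length xs" for a
  proof -
    have "poly w (xs ! a) = 0" using that by (simp add: w_def poly_root_poly_eq_0)
    moreover have "xs ! a \<in> X" using that xs(3) nth_mem by blast
    ultimately show ?thesis using Lr[of "xs ! a"] by (simp add: L_def)
  qed
  have S: "(\<Sum>a<length xs. poly (pderiv w) (xs ! a) * D (xs[a := i])) = - L i w * D xs"
  proof -
    have "L i w * D xs = - (\<Sum>a<length xs. poly (pderiv w) (xs ! a) * D (xs[a := i]))"
      using cr Lw Lr[OF i(1)] by (simp add: sum_negf)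
    then show ?thesis by simp
  qed
  have "(\<Sum>j\<in>set xs. (\<psi> (map (transpose i j) xs) - \<psi> xs) / (i - j))
      = (\<Sum>j\<in>set xs. \<psi> (map (transpose i j) xs) / (i - j)) - \<psi> xs * (\<Sum>j\<in>set xs. 1 / (i - j))"
    by (simp add: diff_divide_distrib sum_subtractf sum_distrib_left)
  also have "(\<Sum>j\<in>set xs. \<psi> (map (transpose i j) xs) / (i - j))
      = (\<Sum>a<length xs. \<psi> (map (transpose i (xs ! a)) xs) / (i - xs ! a))"
    using bij_betw_nth[OF xs(2) refl refl] by (intro sum.reindex_bij_betw[symmetric]) auto
  also have "\<dots> = (\<Sum>a<length xs. poly (pderiv w) (xs ! a) * D (xs[a := i])) / (V * poly w i)"
    by (simp add: \<psi>a sum_divide_distrib)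
  also have "\<dots> = - L i w * D xs / (V * poly w i)" using S by simp
  also have "(\<Sum>j\<in>set xs. 1 / (i - j)) = poly (pderiv w) i / poly w i"
    unfolding w_def using i by (intro sum_inverse_diff_root_poly) auto
  \<comment> \<open>The derivative part of \<open>L i w\<close> cancels against the logarithmic
    derivative of \<open>w\<close>, leaving only the \<open>c i\<close> part.\<close>
  also have "- L i w * D xs / (V * poly w i) - \<psi> xs * (poly (pderiv w) i / poly w i) = - c i * \<psi> xs"
  proof -
    have Liw: "L i w = c i * poly w i - poly (pderiv w) i" by (simp add: L_def)
    show ?thesis
      using V wi unfolding \<psi>_def V_def[symmetric] Liw by (simp add: field_simps)
  qed
  finally show ?thesis .
qed

text \<open>Replacing \<open>i\<close> by a variable \<open>x\<close> turns \<open>\<psi>\<close> into \<open>g x / (y x * C)\<close> for a polynomial \<open>g\<close>.  With \<open>z\<close> the root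
  polynomial of the points outside \<open>xs - {i}\<close>, the Bethe equations give \<open>g' z - g z' = y h\<close> with \<open>h\<close> of degree
  less than \<open>k\<close>, and the sum is evaluated by Lagrange interpolation of \<open>h\<close>.\<close>

lemma hamiltonian_inside:
  assumes xs: "length xs = k" "distinct xs" "set xs \<subseteq> X" and i: "i \<in> set xs"
  shows "(\<Sum>j\<in>X - set xs. (\<psi> (map (transpose i j) xs) - \<psi> xs) / (i - j)) = - c i * \<psi> xs"
proof -
  obtain a where a: "a < length xs" and ia: "xs ! a = i" using i by (metis in_set_conv_nth)
  define J where "J = set xs - {i}"
  define S where "S = X - set xs"
  define v where "v = root_poly J"
  define s where "s = root_poly S"
  define z where "z = root_poly (insert i S)"
  have iX: "i \<in> X" using i xs by auto
  have finS: "finite S" "i \<notin> S" using fin i by (auto simp: S_def)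
  have J: "finite J" "J \<subseteq> X" "i \<notin> J" using xs by (auto simp: J_def)
  have cardS: "card S = k" unfolding S_def
    using xs fin card_X by (subst card_Diff_subset) (auto simp: distinct_card)
  have cardJ: "card J = k - 1" using xs i by (simp add: J_def distinct_card)
  have k: "k > 0" using a xs by auto
  have z: "z = [:-i, 1:] * s" unfolding z_def s_def using root_poly_insert[OF finS] .
  have "X = J \<union> insert i S" using xs i by (auto simp: J_def S_def)
  then have W: "root_poly X = v * z"
    using J finS root_poly_Un[of J "insert i S"] by (auto simp: v_def z_def J_def S_def)
  have vi: "poly v x \<noteq> 0" if "x \<in> insert i S" for x
    using J that by (auto simp: v_def poly_root_poly_eq_0 J_def S_def)

  obtain q where q: "\<And>x. D (xs[a := x]) = L x q" "degree q < length xs"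
    using det_update_poly[OF a] by blast
  \<comment> \<open>At points of \<open>X\<close>, \<open>N\<close> is the determinant as a function
    of entry \<open>a\<close>, up to the factor \<open>poly y x\<close>. It vanishes when that entry
    repeats one in \<open>J\<close>, so \<open>v\<close> divides it.\<close>
  define N where "N = wronskian y q"
  have N0: "poly N j = 0" if "j \<in> J" for j
  proof -
    from that have j: "j \<in> set xs" "j \<noteq> i" by (auto simp: J_def)
    from j(1) obtain b where b: "b < length xs" "xs ! b = j" by (metis in_set_conv_nth)
    then have "L j q = 0" using det_update_duplicate[of a xs b] a q(1)[of j] ia j(2) by auto
    then show ?thesis using that J nonroot[of j] L_eq_wronskian[of j q] by (auto simp: N_def)
  qed
  have "v dvd N" unfolding v_def using J(1) N0 by (rule root_poly_dvd)
  then obtain g where g: "N = v * g" by auto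
  \<comment> \<open>With this constant the updated Vandermonde determinant is
    \<open>C * poly v x\<close>, so \<open>v\<close> cancels in \<open>\<psi>\<close>.\<close>
  define C where "C = vandermonde xs / poly v i"
  have "vandermonde xs \<noteq> 0" using vandermonde_nonzero xs(2) .
  then have C: "C \<noteq> 0" using vi[of i] by (simp add: C_def)
  have \<psi>x: "\<psi> (xs[a := x]) = poly g x / poly y x / C" if "x \<in> insert i S" for x
  proof -
    have "vandermonde (xs[a := x]) * poly v i = vandermonde xs * poly v x"
      using vandermonde_update[OF xs(2) a, of x] by (simp add: v_def J_def ia)
    then have "vandermonde (xs[a := x]) = C * poly v x"
      using vi[of i] by (simp add: C_def field_simps)
    moreover have "D (xs[a := x]) = poly v x * poly g x / poly y x"
      using that iX by (auto simp: q(1) L_eq_wronskian g S_def simp flip: N_def)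
    ultimately show ?thesis using vi[OF that] by (simp add: \<psi>_def)
  qed
  have \<psi>i: "\<psi> xs = poly g i / poly y i / C"
    using \<psi>x[of i] list_update_id[of xs a] ia by simp

  \<comment> \<open>With \<open>W = root_poly X\<close>, \<open>bethe\<close> makes
    \<open>W N' - W' N\<close> divisible by \<open>y\<close>. Inserting \<open>W = v z\<close> and
    \<open>N = v g\<close> turns it into \<open>v v (g' z - g z')\<close>, and \<open>v\<close>
    cancels because its roots are not roots of \<open>y\<close>.\<close>
  have "y dvd wronskian g z"
  proof -
    obtain t where t: "root_poly X * pderiv (pderiv y) - pderiv (root_poly X) * pderiv y = y * t"
      using bethe by auto
    have pN: "pderiv N = pderiv (pderiv y) * q - y * pderiv (pderiv q)"
      by (simp add: N_def wronskian_def pderiv_diff pderiv_mult algebra_simps)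
    have "root_poly X * pderiv N - pderiv (root_poly X) * N
      = q * (root_poly X * pderiv (pderiv y) - pderiv (root_poly X) * pderiv y)
        - y * (root_poly X * pderiv (pderiv q) - pderiv (root_poly X) * pderiv q)"
      unfolding pN by (simp add: N_def wronskian_def algebra_simps)
    then have "y dvd root_poly X * pderiv N - pderiv (root_poly X) * N"
      unfolding t by simp
    also have "root_poly X * pderiv N - pderiv (root_poly X) * N = v * (v * wronskian g z)"
      unfolding W g by (simp add: wronskian_def pderiv_mult algebra_simps)
    finally have *: "y dvd v * (v * wronskian g z)" .
    have cancel: "y dvd p" if "y dvd v * p" for p
      using J nonroot that dvd_mult_root_poly_cancel[OF J(1), of y p] by (auto simp: v_def)
    show ?thesis using cancel[OF cancel[OF *]] .
  qed
  then obtain h where h: "wronskian g z = y * h" by auto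
  \<comment> \<open>Degrees: \<open>N\<close> has at most \<open>2 k - 2\<close> and
    \<open>v\<close> has \<open>k - 1\<close>, so \<open>g\<close> has at most \<open>k - 1\<close>;
    as \<open>z\<close> has \<open>k + 1\<close>, the product \<open>y h\<close> has at most
    \<open>2 k - 1\<close>.\<close>
  have deg_h: "degree h < k"
  proof (cases "h = 0")
    case False
    then have "wronskian g z \<noteq> 0" unfolding h using y_nonzero by simp
    then have "g \<noteq> 0" by auto
    then have "degree N = (k - 1) + degree g"
      unfolding g by (subst degree_mult_eq) (simp_all add: v_def cardJ)
    moreover have "degree N \<le> k + (k - 1) - 1"
      unfolding N_def using deg_y q(2) xs by (intro degree_wronskian_le) auto
    ultimately have "degree g \<le> k - 1" by linarith
    then have "degree (wronskian g z) \<le> (k - 1) + (k + 1) - 1"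
      using cardS finS by (intro degree_wronskian_le) (auto simp: z_def)
    moreover have "degree (y * h) = k + degree h"
      using False y_nonzero deg_y by (simp add: degree_mult_eq)
    ultimately show ?thesis using h k by simp
  qed (use k in simp)

  \<comment> \<open>\<open>\<mu>\<close> makes \<open>h - smult \<mu> s\<close> vanish at
    \<open>i\<close>. The quotient \<open>e\<close> has degree below \<open>card S\<close>, and on
    \<open>S\<close>, where \<open>s\<close> vanishes, it equals \<open>h\<close> divided by
    \<open>j - i\<close>.\<close>
  define \<mu> where "\<mu> = poly h i / poly s i"
  have si: "poly s i \<noteq> 0" using finS by (simp add: s_def poly_root_poly_eq_0)
  have "poly (h - smult \<mu> s) i = 0" using si by (simp add: \<mu>_def)
  then obtain e where e: "h - smult \<mu> s = [:-i, 1:] * e" using poly_eq_0_iff_dvd by blast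
  have deg_e: "degree e < card S" if "e \<noteq> 0"
  proof -
    have "degree (h - smult \<mu> s) = 1 + degree e"
      unfolding e using that by (subst degree_mult_eq) auto
    moreover have "degree (h - smult \<mu> s) \<le> k"
      using deg_h cardS by (intro degree_diff_le) (auto simp: s_def intro: order.trans[OF degree_smult_le])
    ultimately show ?thesis by (simp add: cardS)
  qed
  have ei: "poly e i = poly (pderiv h) i - \<mu> * poly (pderiv s) i"
    using arg_cong[OF e, of "\<lambda>p. poly (pderiv p) i"]
    by (simp add: pderiv_diff pderiv_smult pderiv_mult pderiv_pCons)
  have G: "poly g j / poly y j = - poly e j / poly (pderiv s) j" if j: "j \<in> S" for j
  proof -
    have "j - i \<noteq> 0" using j finS by auto
    have s0: "poly s j = 0" using j finS by (simp add: s_def poly_root_poly_eq_0)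
    have "poly (pderiv s) j \<noteq> 0"
      unfolding s_def using j finS by (simp add: poly_pderiv_root_poly_in poly_root_poly_eq_0)
    have z1: "poly (pderiv z) j = (j - i) * poly (pderiv s) j" and z0: "poly z j = 0"
      unfolding z pderiv_mult using s0 by (simp_all add: pderiv_pCons algebra_simps)
    have h1: "poly h j = (j - i) * poly e j"
      using arg_cong[OF e, of "\<lambda>p. poly p j"] s0 by (simp add: algebra_simps)
    have "poly y j * poly h j = - poly g j * poly (pderiv z) j"
      using arg_cong[OF h, of "\<lambda>p. poly p j"] z0 by (simp add: wronskian_def)
    then have "(j - i) * (poly y j * poly e j) = (j - i) * (- poly g j * poly (pderiv s) j)"
      unfolding h1 z1 by (simp add: algebra_simps)
    then have "poly y j * poly e j = - poly g j * poly (pderiv s) j"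
      using \<open>j - i \<noteq> 0\<close> by (metis mult_left_cancel)
    moreover have "poly y j \<noteq> 0" using j nonroot by (auto simp: S_def)
    ultimately show ?thesis using \<open>poly (pderiv s) j \<noteq> 0\<close> by (simp add: field_simps)
  qed
  have yi: "poly y i \<noteq> 0" using nonroot iX .
  have z1: "poly z i = 0" "poly (pderiv z) i = poly s i" "poly (pderiv (pderiv z)) i = 2 * poly (pderiv s) i"
    using poly_pderiv_root_poly_insert[OF finS] poly_pderiv2_root_poly_insert[OF finS] finS
    by (simp_all add: z_def s_def poly_root_poly_eq_0)
  have h1: "poly y i * poly h i = - poly g i * poly s i"
    using arg_cong[OF h, of "\<lambda>p. poly p i"] z1 by (simp add: wronskian_def)
  \<comment> \<open>The \<open>g' z'\<close> terms cancel and \<open>z\<close> vanishes at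
    \<open>i\<close>, so the derivative of \<open>y h\<close> there involves no derivative of
    \<open>g\<close>; the value of \<open>y'\<close> brings in \<open>c i\<close>.\<close>
  have "pderiv (wronskian g z) = pderiv (pderiv g) * z - g * pderiv (pderiv z)"
    by (simp add: wronskian_def pderiv_diff pderiv_mult algebra_simps)
  then have "pderiv (y * h) = pderiv (pderiv g) * z - g * pderiv (pderiv z)"
    by (simp only: h)
  from arg_cong[OF this, of "\<lambda>p. poly p i"]
  have h2: "poly y i * poly (pderiv h) i + poly h i * poly (pderiv y) i
      = - poly g i * (2 * poly (pderiv s) i)"
    using z1 by (simp add: pderiv_mult)
  have gi: "poly g i = - poly y i * \<mu>"
    using h1 si by (simp add: \<mu>_def field_simps)
  have hi: "poly h i = \<mu> * poly s i" using si by (simp add: \<mu>_def)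
  have h3: "poly (pderiv h) i = 2 * \<mu> * poly (pderiv s) i - \<mu> * poly s i * c i"
  proof -
    have "poly y i * poly (pderiv h) i
      = poly y i * (2 * \<mu> * poly (pderiv s) i) - \<mu> * poly s i * poly (pderiv y) i"
      using h2 unfolding gi hi by (simp add: algebra_simps)
    then show ?thesis using yi by (simp add: c_def field_simps)
  qed

  have "(\<Sum>j\<in>S. (\<psi> (map (transpose i j) xs) - \<psi> xs) / (i - j))
      = (\<Sum>j\<in>S. (- (1 / C) * (poly e j / (poly (pderiv s) j * (i - j))) - \<psi> xs * (1 / (i - j))))"
  proof (rule sum.cong[OF refl])
    fix j assume j: "j \<in> S"
    have "map (transpose i j) xs = xs[a := j]"
      using map_transpose_eq_update[OF xs(2) a, of j] j ia by (simp add: S_def)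
    then have "\<psi> (map (transpose i j) xs) = - poly e j / poly (pderiv s) j / C"
      using \<psi>x[of j] G[OF j] j by simp
    then show "(\<psi> (map (transpose i j) xs) - \<psi> xs) / (i - j)
        = - (1 / C) * (poly e j / (poly (pderiv s) j * (i - j))) - \<psi> xs * (1 / (i - j))"
      by (simp add: diff_divide_distrib)
  qed
  also have "\<dots> = - (1 / C) * (\<Sum>j\<in>S. poly e j / (poly (pderiv s) j * (i - j)))
      - \<psi> xs * (\<Sum>j\<in>S. 1 / (i - j))"
    by (simp only: sum_subtractf sum_distrib_left)
  also have "\<dots> = - (1 / C) * (poly e i / poly s i) - \<psi> xs * (poly (pderiv s) i / poly s i)"
    using lagrange_outside[OF finS(1) deg_e finS(2)] sum_inverse_diff_root_poly[OF finS]
    by (simp add: s_def)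
  also have "\<dots> = - c i * \<psi> xs"
    unfolding \<psi>i gi ei h3 using yi si C by (simp add: field_simps)
  finally show ?thesis by (simp add: S_def)
qed

text \<open>Swaps inside the list contribute nothing by symmetry of \<open>\<psi>\<close>, and swaps
  outside it fix the list; only crossing pairs remain.\<close>

lemma hamiltonian:
  assumes xs: "length xs = k" "distinct xs" "set xs \<subseteq> X" and i: "i \<in> X"
  shows "(\<Sum>j\<in>X - {i}. (\<psi> (map (transpose i j) xs) - \<psi> xs) / (i - j)) = - c i * \<psi> xs"
proof (cases "i \<in> set xs")
  case True
  have "(\<Sum>j\<in>X - {i}. (\<psi> (map (transpose i j) xs) - \<psi> xs) / (i - j))
    = (\<Sum>j\<in>X - set xs. (\<psi> (map (transpose i j) xs) - \<psi> xs) / (i - j))"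
    using fin True xs by (intro sum.mono_neutral_right) (auto simp: \<psi>_swap)
  then show ?thesis using hamiltonian_inside[OF xs True] by simp
next
  case False
  have "(\<Sum>j\<in>X - {i}. (\<psi> (map (transpose i j) xs) - \<psi> xs) / (i - j))
    = (\<Sum>j\<in>set xs. (\<psi> (map (transpose i j) xs) - \<psi> xs) / (i - j))"
    using fin False xs by (intro sum.mono_neutral_right) (auto simp: map_transpose_id)
  then show ?thesis using hamiltonian_outside[OF xs i False] by simp
qed

section \<open>Nonvanishing of the eigenvector and reality of the eigenvalues\<close>

lemma \<psi>_nonzero: "\<exists>xs. length xs = k \<and> distinct xs \<and> set xs \<subseteq> X \<and> \<psi> xs \<noteq> 0"
proof -
  have "q = 0" if q: "\<forall>x\<in>X. L x q = 0" "degree q < k" for q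
  proof (rule ccontr)
    assume "q \<noteq> 0"
    have "wronskian y q = 0"
    proof (rule poly_eq_0_of_many_roots[OF _ fin])
      show "poly (wronskian y q) x = 0" if "x \<in> X" for x
        using q(1) that nonroot[OF that] L_eq_wronskian[OF that, of q] by simp
      have "degree (wronskian y q) \<le> k + (k - 1) - 1"
        using q(2) deg_y by (intro degree_wronskian_le) auto
      then show "degree (wronskian y q) < card X" using q(2) by (simp add: card_X)
    qed
    then have "degree y = degree q"
      using wronskian_eq_0_imp_degree_eq y_nonzero \<open>q \<noteq> 0\<close> by blast
    then show False using q(2) deg_y by simp
  qed
  then obtain xs where "length xs = k" "distinct xs" "set xs \<subseteq> X" "D xs \<noteq> 0"
    using exists_nonzero_det by blast
  then show ?thesis using vandermonde_nonzero[of xs] by (auto simp: \<psi>_def)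
qed

text \<open>Rayleigh quotient: pairing the eigenvalue equation with the conjugate of
  \<open>\<psi>\<close> writes \<open>- c i * n\<close> through the real numbers \<open>A j\<close>,
  \<open>n\<close> and \<open>i - j\<close>, and \<open>n > 0\<close>.\<close>

lemma c_real:
  assumes "X \<subseteq> \<real>" "i \<in> X"
  shows "c i \<in> \<real>"
proof -
  \<comment> \<open>Each set is counted \<open>k!\<close> times, which scales \<open>n\<close> and
    every \<open>A j\<close> alike.\<close>
  define F where "F = {xs. length xs = k \<and> distinct xs \<and> set xs \<subseteq> X}"
  have "finite {xs. set xs \<subseteq> X \<and> length xs = k}" using fin by (rule finite_lists_length_eq)
  then have finF: "finite F" by (rule finite_subset[rotated]) (auto simp: F_def)
  have tF: "map (transpose i j) xs \<in> F" if "xs \<in> F" "j \<in> X" for xs j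
    using that assms by (auto simp: F_def distinct_map inj_on_def transpose_def)
  define n where "n = (\<Sum>xs\<in>F. cnj (\<psi> xs) * \<psi> xs)"
  have norm: "n = of_real (\<Sum>xs\<in>F. (cmod (\<psi> xs))\<^sup>2)"
    unfolding n_def of_real_sum by (intro sum.cong refl) (metis complex_norm_square mult.commute of_real_power)
  define A where "A j = (\<Sum>xs\<in>F. cnj (\<psi> xs) * \<psi> (map (transpose i j) xs))" for j
  have A: "A j \<in> \<real>" if "j \<in> X" for j
  proof -
    \<comment> \<open>Symmetry of the swap operator: reindexing by the involution moves the swap to
      the other factor.\<close>
    have "cnj (A j) = (\<Sum>xs\<in>F. \<psi> xs * cnj (\<psi> (map (transpose i j) xs)))"
      by (simp add: A_def)
    also have "\<dots> = A j" unfolding A_def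
      by (rule sum.reindex_bij_witness[of _ "map (transpose i j)" "map (transpose i j)"])
        (use tF that in \<open>auto simp: mult.commute simp del: map_map\<close>)
    finally show ?thesis by (simp add: Reals_cnj_iff)
  qed
  have "- c i * n = (\<Sum>xs\<in>F. cnj (\<psi> xs) * (- c i * \<psi> xs))"
    by (simp add: n_def sum_distrib_left mult_ac)
  also have "\<dots> = (\<Sum>xs\<in>F. cnj (\<psi> xs) * (\<Sum>j\<in>X - {i}. (\<psi> (map (transpose i j) xs) - \<psi> xs) / (i - j)))"
    using assms by (intro sum.cong refl) (subst hamiltonian, auto simp: F_def)
  also have "\<dots> = (\<Sum>j\<in>X - {i}. (A j - n) / (i - j))"
    unfolding sum_distrib_left A_def n_def
    by (subst sum.swap) (simp add: sum_subtractf[symmetric] sum_divide_distrib right_diff_distrib)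
  also have "\<dots> \<in> \<real>"
    using A assms norm by (intro sum_in_Reals Reals_divide Reals_diff) (auto simp: subset_iff)
  finally have "c i * n \<in> \<real>" by (metis Reals_minus minus_mult_left minus_minus)
  moreover have "n \<in> \<real>" "n \<noteq> 0"
  proof -
    show "n \<in> \<real>" by (simp add: norm)
    obtain xs where "xs \<in> F" "\<psi> xs \<noteq> 0" using \<psi>_nonzero by (auto simp: F_def)
    then have "(\<Sum>xs\<in>F. (cmod (\<psi> xs))\<^sup>2) > 0"
      using finF by (intro sum_pos2[of F xs]) auto
    then show "n \<noteq> 0" unfolding norm by (metis less_irrefl of_real_eq_0_iff)
  qed
  ultimately have "c i * n / n \<in> \<real>" by (intro Reals_divide)
  then show ?thesis using \<open>n \<noteq> 0\<close> by simp
qed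

end

section \<open>Reality of polynomials\<close>

abbreviation conj_poly :: "complex poly \<Rightarrow> complex poly" where
  "conj_poly \<equiv> map_poly cnj"

lemma coeff_conj_poly [simp]: "coeff (conj_poly p) n = cnj (coeff p n)"
  by (simp add: coeff_map_poly)

lemma degree_conj_poly [simp]: "degree (conj_poly p) = degree p"
  by (simp add: degree_map_poly)

lemma conj_poly_diff: "conj_poly (p - q) = conj_poly p - conj_poly q"
  by (intro poly_eqI) simp

lemma conj_poly_smult: "conj_poly (smult a p) = smult (cnj a) (conj_poly p)"
  by (intro poly_eqI) simp

lemma conj_poly_mult: "conj_poly (p * q) = conj_poly p * conj_poly q"
  by (intro poly_eqI) (simp add: coeff_mult)

lemma conj_poly_pderiv: "conj_poly (pderiv p) = pderiv (conj_poly p)"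
  by (intro poly_eqI) (simp add: coeff_pderiv)

lemma conj_poly_wronskian: "conj_poly (wronskian p q) = wronskian (conj_poly p) (conj_poly q)"
  by (simp add: wronskian_def conj_poly_diff conj_poly_mult conj_poly_pderiv)

lemma conj_poly_conj_poly [simp]: "conj_poly (conj_poly p) = p"
  by (intro poly_eqI) simp

lemma conj_poly_root_poly:
  assumes "X \<subseteq> \<real>"
  shows "conj_poly (root_poly X) = root_poly X"
proof -
  have "poly (conj_poly (root_poly X)) x = poly (root_poly X) x" for x
    using assms by (auto simp: poly_root_poly Reals_cnj_iff subset_iff intro!: prod.cong)
  then show ?thesis by (auto simp flip: poly_eq_poly_eq_iff)
qed

lemma (in gaudin) conj_poly_monic_solution:
  assumes X: "X \<subseteq> \<real>" and monic: "lead_coeff y = 1"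
  shows "conj_poly y = y"
proof -
  have "wronskian y (conj_poly y) = 0"
  proof (rule poly_eq_0_of_many_roots[OF _ fin])
    fix x assume x: "x \<in> X"
    have "poly (pderiv y) x = c x * poly y x" using nonroot[OF x] by (simp add: c_def)
    moreover have "cnj (c x) = c x" "cnj x = x"
      using c_real[OF X x] x X by (auto simp: Reals_cnj_iff)
    ultimately show "poly (wronskian y (conj_poly y)) x = 0"
      by (simp add: wronskian_def flip: conj_poly_pderiv)
  next
    assume nz: "wronskian y (conj_poly y) \<noteq> 0"
    \<comment> \<open>At \<open>k = 0\<close> the bound \<open>k + k - 1\<close> truncates to 0,
      which is not below \<open>card X = 0\<close>.\<close>
    have "k \<noteq> 0"
    proof
      assume "k = 0"
      then have "pderiv y = 0" "pderiv (conj_poly y) = 0"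
        using deg_y by (simp_all add: pderiv_eq_0_of_degree)
      then show False using nz by (simp add: wronskian_def)
    qed
    moreover have "degree (wronskian y (conj_poly y)) \<le> k + k - 1"
      using deg_y by (intro degree_wronskian_le) auto
    ultimately show "degree (wronskian y (conj_poly y)) < card X" by (simp add: card_X)
  qed
  moreover have "conj_poly y \<noteq> 0" using y_nonzero by (metis conj_poly_conj_poly map_poly_0)
  ultimately obtain b where b: "y = smult b (conj_poly y)"
    using wronskian_eq_0_imp_smult by blast
  have "b = 1" using arg_cong[OF b, of "\<lambda>p. coeff p (degree y)"] monic by simp
  then show ?thesis using b by simp
qed

lemma real_basis:
  fixes y b :: "complex poly"
  assumes X: "finite X" "X \<subseteq> \<real>" "card X = 2 * k"
    and y: "degree y \<le> k" "\<And>x. x \<in> X \<Longrightarrow> poly y x \<noteq> 0"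
    and b: "degree b \<le> k + 1"
    and w: "wronskian b y \<noteq> 0" "\<And>x. x \<in> X \<Longrightarrow> poly (wronskian b y) x = 0"
  obtains s t r where "s \<noteq> 0" "r \<noteq> 0" "conj_poly (smult s y) = smult s y"
    "conj_poly (smult r b + smult t y) = smult r b + smult t y"
proof -
  have "y \<noteq> 0" using w(1) by (auto simp: wronskian_def)
  \<comment> \<open>The \<open>2 k\<close> known roots exhaust the degree bound
    \<open>(k + 1) + k - 1\<close>: so \<open>g\<close> is constant and \<open>y\<close> cannot have
    degree below \<open>k\<close>.\<close>
  obtain g where g: "wronskian b y = root_poly X * g"
    using root_poly_dvd[OF X(1) w(2)] by auto
  have g0: "g \<noteq> 0" using w(1) g by auto
  have deg_w: "degree (wronskian b y) = 2 * k + degree g"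
    unfolding g using g0 X(3) by (subst degree_mult_eq) auto
  have deg_y: "degree y = k"
  proof (rule ccontr)
    assume "degree y \<noteq> k"
    then have "degree y \<le> k - 1" "k > 0" using y(1) by auto
    then have "degree (wronskian b y) \<le> (k + 1) + (k - 1) - 1"
      using b by (intro degree_wronskian_le)
    then show False using deg_w \<open>k > 0\<close> by simp
  qed
  have "degree (wronskian b y) \<le> (k + 1) + k - 1"
    using b y by (intro degree_wronskian_le)
  then have "degree g = 0" using deg_w by simp
  then obtain a where a: "g = [:a:]" by (rule degree_eq_zeroE)
  with g0 have "a \<noteq> 0" by auto
  \<comment> \<open>\<open>s\<close> makes \<open>Y\<close> monic and \<open>r\<close> absorbs
    \<open>a\<close>, so that the Wronskian of \<open>B\<close> and \<open>Y\<close> is exactly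
    \<open>root_poly X\<close>.\<close>
  define s where "s = 1 / lead_coeff y"
  have "s \<noteq> 0" using \<open>y \<noteq> 0\<close> by (simp add: s_def)
  define r where "r = 1 / (a * s)"
  have "r \<noteq> 0" using \<open>a \<noteq> 0\<close> \<open>s \<noteq> 0\<close> by (simp add: r_def)
  define Y where "Y = smult s y"
  define B where "B = smult r b"
  have "Y \<noteq> 0" using \<open>s \<noteq> 0\<close> \<open>y \<noteq> 0\<close> by (simp add: Y_def)
  have W: "wronskian B Y = root_poly X"
    using \<open>a \<noteq> 0\<close> \<open>s \<noteq> 0\<close> g unfolding a
    by (simp add: Y_def B_def wronskian_smult_left wronskian_smult_right r_def)
  interpret gaudin Y X k
  proof
    \<comment> \<open>After substituting \<open>B' Y - B Y'\<close> for \<open>root_poly X\<close>,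
      the terms with undifferentiated \<open>B\<close> cancel and a multiple of \<open>Y\<close>
      remains.\<close>
    have "root_poly X * pderiv (pderiv Y) - pderiv (root_poly X) * pderiv Y
      = Y * (pderiv B * pderiv (pderiv Y) - pderiv (pderiv B) * pderiv Y)"
      unfolding W[symmetric] by (simp add: wronskian_def pderiv_diff pderiv_mult algebra_simps)
    then show "Y dvd root_poly X * pderiv (pderiv Y) - pderiv (root_poly X) * pderiv Y" by simp
  qed (use X y deg_y \<open>s \<noteq> 0\<close> \<open>Y \<noteq> 0\<close> in \<open>auto simp: Y_def\<close>)
  have cY: "conj_poly Y = Y"
    using X(2) \<open>y \<noteq> 0\<close> \<open>s \<noteq> 0\<close> by (intro conj_poly_monic_solution) (auto simp: Y_def s_def)
  \<comment> \<open>As \<open>Y\<close> and \<open>root_poly X\<close> are real, \<open>B\<close>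
    and its conjugate differ by a multiple \<open>m\<close> of \<open>Y\<close>. This
    \<open>m\<close> is purely imaginary, so subtracting \<open>m / 2\<close> times \<open>Y\<close>
    makes \<open>B\<close> real.\<close>
  have "wronskian (B - conj_poly B) Y = wronskian B Y - conj_poly (wronskian B Y)"
    by (simp add: wronskian_diff_left conj_poly_wronskian cY)
  also have "\<dots> = 0" unfolding W conj_poly_root_poly[OF X(2)] by simp
  finally obtain m where m: "B - conj_poly B = smult m Y"
    using wronskian_eq_0_imp_smult \<open>Y \<noteq> 0\<close> by blast
  have "smult (cnj m) Y = conj_poly (B - conj_poly B)" unfolding m by (simp add: conj_poly_smult cY)
  also have "\<dots> = - (B - conj_poly B)" by (simp add: conj_poly_diff)
  finally have "smult (cnj m) Y = - smult m Y" unfolding m .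
  then have "smult (cnj m + m) Y = 0" by (simp add: smult_add_left)
  then have cm: "cnj m = - m" using \<open>Y \<noteq> 0\<close> by (simp add: eq_neg_iff_add_eq_0)
  have "conj_poly B = B - smult m Y" using m by (simp add: algebra_simps)
  then have cB: "conj_poly (B - smult (m / 2) Y) = B - smult (m / 2) Y"
    by (simp add: conj_poly_diff conj_poly_smult cY cm flip: smult_diff_left smult_add_left)
  show thesis
  proof (rule that[of s r "- (m / 2 * s)"])
    show "conj_poly (smult r b + smult (- (m / 2 * s)) y) = smult r b + smult (- (m / 2 * s)) y"
      using cB by (simp add: B_def Y_def)
  qed (use \<open>s \<noteq> 0\<close> \<open>r \<noteq> 0\<close> cY in \<open>auto simp: Y_def\<close>)
qed

section \<open>Change of coordinate\<close>

text \<open>The reversal \<open>u ^ d * p (1 / u)\<close> for a formal degree \<open>d\<close>,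
  which may exceed \<open>degree p\<close>.\<close>

definition flip_poly :: "nat \<Rightarrow> 'a::comm_semiring_1 poly \<Rightarrow> 'a poly" where
  "flip_poly d p = (\<Sum>i\<le>d. monom (coeff p (d - i)) i)"

lemma coeff_flip_poly: "coeff (flip_poly d p) m = (if m \<le> d then coeff p (d - m) else 0)"
  by (simp add: flip_poly_def coeff_sum)

lemma degree_flip_poly_le: "degree (flip_poly d p) \<le> d"
  by (intro degree_le) (simp add: coeff_flip_poly)

lemma flip_poly_add: "flip_poly d (p + q) = flip_poly d p + flip_poly d q"
  by (intro poly_eqI) (simp add: coeff_flip_poly)

lemma flip_poly_smult: "flip_poly d (smult a p) = smult a (flip_poly d p)"
  by (intro poly_eqI) (simp add: coeff_flip_poly)

lemma flip_poly_eq_0: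
  assumes "degree p \<le> d" "flip_poly d p = 0"
  shows "p = 0"
proof (rule poly_eqI)
  fix n
  show "coeff p n = coeff 0 n"
    using assms(1) arg_cong[OF assms(2), of "\<lambda>q. coeff q (d - n)"]
    by (cases "n \<le> d") (auto simp: coeff_flip_poly coeff_eq_0)
qed

lemma poly_flip_poly_0: "poly (flip_poly d p) 0 = coeff p d"
  by (simp add: poly_0_coeff_0 coeff_flip_poly)

lemma poly_flip_poly:
  fixes p :: "'a::field poly"
  assumes "degree p \<le> d" "u \<noteq> 0"
  shows "poly (flip_poly d p) u = u ^ d * poly p (1 / u)"
proof -
  have "poly p (1 / u) = (\<Sum>i\<le>d. coeff p i * (1 / u) ^ i)"
    unfolding poly_altdef using assms(1)
    by (intro sum.mono_neutral_left) (auto simp: coeff_eq_0)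
  then have "u ^ d * poly p (1 / u) = (\<Sum>i\<le>d. coeff p i * u ^ (d - i))"
    using assms(2) by (simp add: sum_distrib_left power_one_over power_diff field_simps)
  also have "\<dots> = (\<Sum>i\<le>d. coeff p (d - i) * u ^ i)"
    by (rule sum.reindex_bij_witness[of _ "\<lambda>i. d - i" "\<lambda>i. d - i"]) auto
  also have "\<dots> = poly (flip_poly d p) u"
    by (simp add: flip_poly_def poly_sum poly_monom)
  finally show ?thesis by simp
qed

lemma poly_eqI_nonzero:
  fixes p q :: "'a::{idom,ring_char_0} poly"
  assumes "\<And>u. u \<noteq> 0 \<Longrightarrow> poly p u = poly q u"
  shows "p = q"
proof -
  have "poly ([:0, 1:] * (p - q)) u = 0" for u
    using assms[of u] by (cases "u = 0") auto
  then have "[:0, 1:] * (p - q) = 0" using poly_all_0_iff_0 by blast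
  then show ?thesis by simp
qed

text \<open>The Euler operator \<open>u d/du\<close> multiplies the coefficient at \<open>n\<close>
  by \<open>n\<close>, and reversal exchanges \<open>n\<close> with \<open>d - n\<close>.\<close>

lemma pCons_0_pderiv_flip_poly:
  fixes p :: "'a::{idom} poly"
  shows "pCons 0 (pderiv (flip_poly d p))
    = smult (of_nat d) (flip_poly d p) - flip_poly d (pCons 0 (pderiv p))"
proof (rule poly_eqI)
  have *: "coeff (pCons 0 (pderiv r)) n = of_nat n * coeff r n" for r :: "'a poly" and n
    by (cases n) (simp_all add: coeff_pderiv)
  show "coeff (pCons 0 (pderiv (flip_poly d p))) n
    = coeff (smult (of_nat d) (flip_poly d p) - flip_poly d (pCons 0 (pderiv p))) n" for n
    by (simp add: * coeff_flip_poly of_nat_diff algebra_simps)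
qed

text \<open>The bound holds because the coefficient at \<open>2 d - 1\<close> cancels. In the
  identity, the multiples of \<open>d\<close> produced by the Euler operator cancel by
  antisymmetry.\<close>

lemma wronskian_flip_poly:
  fixes p q :: "'a::field_char_0 poly"
  assumes p: "degree p \<le> d" and q: "degree q \<le> d"
  shows "degree (wronskian p q) \<le> 2 * d - 2"
    and "wronskian (flip_poly d p) (flip_poly d q) = - flip_poly (2 * d - 2) (wronskian p q)"
proof -
  show deg: "degree (wronskian p q) \<le> 2 * d - 2"
  proof (rule degree_le, intro allI impI)
    fix n assume n: "2 * d - 2 < n"
    show "coeff (wronskian p q) n = 0"
    proof (cases "n = d + d - 1")
      case True
      then show ?thesis using coeff_wronskian_top[OF p q] by simp
    next
      case False
      then show ?thesis using n degree_wronskian_le[OF p q] by (intro coeff_eq_0) linarith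
    qed
  qed
  show "wronskian (flip_poly d p) (flip_poly d q) = - flip_poly (2 * d - 2) (wronskian p q)"
  proof (cases "d = 0")
    case True
    then have "pderiv p = 0" "pderiv q = 0" "pderiv (flip_poly d p) = 0" "pderiv (flip_poly d q) = 0"
      using p q degree_flip_poly_le[of d p] degree_flip_poly_le[of d q]
      by (simp_all add: pderiv_eq_0_of_degree)
    then have "wronskian p q = 0" "wronskian (flip_poly d p) (flip_poly d q) = 0"
      by (simp_all add: wronskian_def)
    then show ?thesis by (simp add: flip_poly_def)
  next
    case False
    show ?thesis
    proof (rule poly_eqI_nonzero)
      fix u :: 'a assume u: "u \<noteq> 0"
      have euler: "u * poly (pderiv (flip_poly d r)) u
          = of_nat d * poly (flip_poly d r) u - u ^ d * (1 / u * poly (pderiv r) (1 / u))"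
        if "degree r \<le> d" for r
      proof -
        have "degree (pCons 0 (pderiv r)) \<le> d"
          using that False by (cases "pderiv r = 0") (auto simp: degree_pderiv)
        then show ?thesis
          using arg_cong[OF pCons_0_pderiv_flip_poly[of d r], of "\<lambda>q. poly q u"] u
          by (simp add: poly_flip_poly)
      qed
      have "u\<^sup>2 * poly (wronskian (flip_poly d p) (flip_poly d q)) u
        = u * ((u * poly (pderiv (flip_poly d p)) u) * poly (flip_poly d q) u
            - poly (flip_poly d p) u * (u * poly (pderiv (flip_poly d q)) u))"
        by (simp add: wronskian_def power2_eq_square algebra_simps)
      also have "\<dots> = - (u ^ d * u ^ d * poly (wronskian p q) (1 / u))"
        unfolding euler[OF p] euler[OF q] poly_flip_poly[OF p u] poly_flip_poly[OF q u]
        using u by (simp add: wronskian_def field_simps)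
      also have "u ^ d * u ^ d = u\<^sup>2 * u ^ (2 * d - 2)"
        using False by (cases d) (simp_all add: power2_eq_square power_add mult_2)
      also have "- (u\<^sup>2 * u ^ (2 * d - 2) * poly (wronskian p q) (1 / u))
        = u\<^sup>2 * poly (- flip_poly (2 * d - 2) (wronskian p q)) u"
        by (simp add: poly_flip_poly[OF deg u])
      finally show "poly (wronskian (flip_poly d p) (flip_poly d q)) u
        = poly (- flip_poly (2 * d - 2) (wronskian p q)) u"
        using u by (metis mult_left_cancel power_not_zero)
    qed
  qed
qed

lemma coeff_pcompose_translate:
  fixes p :: "'a::idom poly"
  assumes "degree p \<le> n"
  shows "coeff (pcompose p [:a, 1:]) n = coeff p n"
proof (cases "degree p = n")
  case True
  then show ?thesis using lead_coeff_comp[of "[:a, 1:]" p] by (simp add: degree_pcompose)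
next
  case False
  then show ?thesis using assms by (simp add: coeff_eq_0 degree_pcompose)
qed

text \<open>The effect on polynomials of degree at most \<open>d\<close> of the substitution
  \<open>z = a + 1 / u\<close>, cleared of denominators.\<close>

definition recenter :: "nat \<Rightarrow> 'a::field \<Rightarrow> 'a poly \<Rightarrow> 'a poly" where
  "recenter d a p = flip_poly d (pcompose p [:a, 1:])"

lemma recenter_add: "recenter d a (p + q) = recenter d a p + recenter d a q"
  by (simp add: recenter_def pcompose_add flip_poly_add)

lemma recenter_smult: "recenter d a (smult c p) = smult c (recenter d a p)"
  by (simp add: recenter_def pcompose_smult flip_poly_smult)

lemma poly_recenter:
  assumes "degree p \<le> d" "u \<noteq> 0"
  shows "poly (recenter d a p) u = u ^ d * poly p (a + 1 / u)"
  using assms by (simp add: recenter_def poly_flip_poly degree_pcompose poly_pcompose)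

lemma poly_recenter_0: "degree p \<le> d \<Longrightarrow> poly (recenter d a p) 0 = coeff p d"
  by (simp add: recenter_def poly_flip_poly_0 coeff_pcompose_translate)

lemma coeff_recenter_top: "coeff (recenter d a p) d = poly p a"
  by (simp add: recenter_def coeff_flip_poly)

lemma recenter_eq_0: "degree p \<le> d \<Longrightarrow> recenter d a p = 0 \<Longrightarrow> p = 0"
  unfolding recenter_def
  by (drule flip_poly_eq_0[rotated]) (auto simp: degree_pcompose pcompose_eq_0_iff)

lemma wronskian_recenter:
  fixes p q :: "'a::field_char_0 poly"
  assumes "degree p \<le> d" "degree q \<le> d"
  shows "wronskian (recenter d a p) (recenter d a q) = - recenter (2 * d - 2) a (wronskian p q)"
proof -
  have "wronskian (pcompose p [:a, 1:]) (pcompose q [:a, 1:]) = pcompose (wronskian p q) [:a, 1:]"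
    by (simp add: wronskian_def pderiv_pcompose pderiv_pCons pcompose_diff pcompose_mult)
  then show ?thesis
    using assms by (simp add: recenter_def wronskian_flip_poly(2) degree_pcompose)
qed

lemma conj_poly_recenter:
  assumes "p \<in> \<real>"
  shows "conj_poly (recenter d p F) = recenter d p (conj_poly F)"
proof -
  have "poly (conj_poly (pcompose F [:p, 1:])) x = poly (pcompose (conj_poly F) [:p, 1:]) x" for x
    using assms by (simp add: poly_pcompose Reals_cnj_iff)
  then have *: "conj_poly (pcompose F [:p, 1:]) = pcompose (conj_poly F) [:p, 1:]"
    by (auto simp flip: poly_eq_poly_eq_iff)
  show ?thesis unfolding recenter_def *[symmetric]
    by (intro poly_eqI) (simp add: coeff_flip_poly)
qed

text \<open>Recentering at a real point commutes with conjugation and is injective in degree at most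
  \<open>d\<close>.\<close>

lemma conj_poly_eq_of_recenter:
  assumes "p \<in> \<real>" "degree F \<le> d" "conj_poly (recenter d p F) = recenter d p F"
  shows "conj_poly F = F"
proof -
  have "recenter d p (conj_poly F + smult (- 1) F) = 0"
    unfolding recenter_add recenter_smult
    using assms(3) by (simp add: conj_poly_recenter[OF assms(1)])
  moreover have "degree (conj_poly F + smult (- 1) F) \<le> d"
    using assms(2) by (intro degree_add_le) auto
  ultimately have "conj_poly F + smult (- 1) F = 0" using recenter_eq_0 by blast
  then show ?thesis by simp
qed

section \<open>Critical points and Moebius maps\<close>

lemma wronskian_nonzero:
  fixes P Q :: "'a::field_char_0 poly"
  assumes "coprime P Q" "Q \<noteq> 0" "max (degree P) (degree Q) > 0"
  shows "wronskian P Q \<noteq> 0"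
proof
  assume "wronskian P Q = 0"
  then obtain c where c: "P = smult c Q" using wronskian_eq_0_imp_smult assms(2) by blast
  then have "Q dvd P" by (simp add: dvd_smult)
  then have "is_unit Q" using assms(1) by (metis coprime_common_divisor dvd_refl)
  then have "degree Q = 0" using assms(2) by (simp add: is_unit_iff_degree)
  then show False using assms(3) c by (simp add: max_def split: if_splits)
qed

lemma wronskian_eq_0_at_critical:
  fixes F G :: "complex poly"
  assumes "((\<lambda>h. poly F (a + h) / poly G (a + h)) has_field_derivative 0) (at 0)" "poly G a \<noteq> 0"
  shows "poly (wronskian F G) a = 0"
proof -
  have "((\<lambda>h. poly F (a + h) / poly G (a + h)) has_field_derivative
      (poly (pderiv F) a * poly G a - poly F a * poly (pderiv G) a) / (poly G a * poly G a)) (at 0)"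
    using assms(2) by (auto intro!: derivative_eq_intros DERIV_chain'[OF _ poly_DERIV])
  from DERIV_unique[OF assms(1) this] assms(2) show ?thesis by (simp add: wronskian_def)
qed

lemma wronskian_eq_0_at_finite_critical_point:
  assumes "coprime P Q" "Some z \<in> critical_points (ratio_map P Q)"
  shows "poly (wronskian P Q) z = 0"
proof (cases "poly Q z = 0")
  case False
  \<comment> \<open>The functions agree at poles too: \<open>local_coord\<close> gives 0 there, and
    so does division by zero.\<close>
  have "(\<lambda>h. local_coord (ratio_map P Q (Some z)) (ratio_map P Q (local_param (Some z) h)))
    = (\<lambda>h. poly P (z + h) / poly Q (z + h))"
    using False by auto
  then show ?thesis
    using assms(2) False by (intro wronskian_eq_0_at_critical) (simp_all add: critical_points_def)
next
  case True
  then have P: "poly P z \<noteq> 0" using assms(1) by (metis coprime_poly_0)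
  \<comment> \<open>At a pole the chart at infinity inverts the quotient, which only changes the
    sign of the Wronskian.\<close>
  have "(\<lambda>h. local_coord (ratio_map P Q (Some z)) (ratio_map P Q (local_param (Some z) h)))
    = (\<lambda>h. poly Q (z + h) / poly P (z + h))"
    using True by auto
  then have "poly (wronskian Q P) z = 0"
    using assms(2) P by (intro wronskian_eq_0_at_critical) (simp_all add: critical_points_def)
  then show ?thesis by (simp add: wronskian_swap[of P Q])
qed

lemma coprime_top_coeff:
  assumes "coprime P Q" "Q \<noteq> 0" "d = max (degree P) (degree Q)"
  shows "coeff P d \<noteq> 0 \<or> coeff Q d \<noteq> 0"
proof (cases "d = degree Q")
  case False
  then have "d = degree P" "degree P > 0" using assms(3) by (auto simp: max_def split: if_splits)
  then show ?thesis by auto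
qed (use assms(2) in simp)

text \<open>In the chart \<open>1 / h\<close> the map is the quotient of the reversed polynomials,
  whose Wronskian at 0 is minus this coefficient.\<close>

lemma coeff_wronskian_eq_0_at_infinite_critical_point:
  assumes "coprime P Q" "Q \<noteq> 0" and d: "d = max (degree P) (degree Q)"
    and crit: "None \<in> critical_points (ratio_map P Q)"
  shows "coeff (wronskian P Q) (2 * d - 2) = 0"
proof -
  let ?F = "flip_poly d P" and ?G = "flip_poly d Q"
  have deg: "degree P \<le> d" "degree Q \<le> d" using d by auto
  have F0: "poly ?F 0 = coeff P d" and G0: "poly ?G 0 = coeff Q d"
    by (simp_all add: poly_flip_poly_0)
  have val: "ratio_map P Q (local_param None h) = (if poly ?G h = 0 then None else Some (poly ?F h / poly ?G h))"
    for h
    using poly_flip_poly[of P d h] poly_flip_poly[of Q d h] deg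
    by (cases "h = 0") (simp_all add: F0 G0 flip: d)
  have "poly (wronskian ?F ?G) 0 = 0"
  proof (cases "coeff Q d = 0")
    case False
    have "(\<lambda>h. local_coord (ratio_map P Q None) (ratio_map P Q (local_param None h)))
      = (\<lambda>h. poly ?F (0 + h) / poly ?G (0 + h))"
      unfolding val using False by (auto simp flip: d)
    then show ?thesis
      using crit False G0 by (intro wronskian_eq_0_at_critical) (simp_all add: critical_points_def)
  next
    case True
    then have P: "coeff P d \<noteq> 0" using coprime_top_coeff assms by blast
    have "(\<lambda>h. local_coord (ratio_map P Q None) (ratio_map P Q (local_param None h)))
      = (\<lambda>h. poly ?G (0 + h) / poly ?F (0 + h))"
      unfolding val using True by (auto simp flip: d)
    then have "poly (wronskian ?G ?F) 0 = 0"
      using crit P F0 by (intro wronskian_eq_0_at_critical) (simp_all add: critical_points_def)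
    then show ?thesis by (simp add: wronskian_swap[of ?F ?G])
  qed
  then show ?thesis
    using deg by (simp add: wronskian_flip_poly(2) poly_flip_poly_0)
qed

section \<open>Moebius maps in homogeneous coordinates\<close>

lemma moebius_quotient:
  assumes "a * e - b * c \<noteq> 0" "\<alpha> \<noteq> 0 \<or> \<beta> \<noteq> 0"
  shows "ratio_map [:b, a:] [:e, c:] (if \<beta> = 0 then None else Some (\<alpha> / \<beta>))
    = (if c * \<alpha> + e * \<beta> = 0 then None else Some ((a * \<alpha> + b * \<beta>) / (c * \<alpha> + e * \<beta>)))"
proof (cases "\<beta> = 0")
  case True
  \<comment> \<open>The determinant excludes \<open>a = c = 0\<close>, so the value at infinity is
    read off in degree 1.\<close>
  then have "max (degree [:b, a:]) (degree [:e, c:]) = 1" using assms by auto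
  then show ?thesis using True assms by auto
next
  case False
  then have "e + \<alpha> / \<beta> * c = (c * \<alpha> + e * \<beta>) / \<beta>" "b + \<alpha> / \<beta> * a = (a * \<alpha> + b * \<beta>) / \<beta>"
    by (simp_all add: field_simps)
  then show ?thesis using False by simp
qed

lemma moebius_comp_ratio_map:
  assumes "coprime P Q" "Q \<noteq> 0" and det: "a * e - b * c \<noteq> 0"
  shows "ratio_map [:b, a:] [:e, c:] \<circ> ratio_map P Q
    = ratio_map (smult a P + smult b Q) (smult c P + smult e Q)"
proof
  fix x
  define d where "d = max (degree P) (degree Q)"
  let ?F = "smult a P + smult b Q" and ?G = "smult c P + smult e Q"
  show "(ratio_map [:b, a:] [:e, c:] \<circ> ratio_map P Q) x = ratio_map ?F ?G x"
  proof (cases x)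
    case None
    have nz: "coeff P d \<noteq> 0 \<or> coeff Q d \<noteq> 0"
      using coprime_top_coeff assms(1,2) d_def by blast
    \<comment> \<open>An invertible linear map cannot kill both top coefficients, so the degree
      defining the value at infinity stays \<open>d\<close>.\<close>
    have "coeff ?F d \<noteq> 0 \<or> coeff ?G d \<noteq> 0"
    proof (rule ccontr)
      assume "\<not> ?thesis"
      then have "a * coeff P d + b * coeff Q d = 0" "c * coeff P d + e * coeff Q d = 0" by auto
      moreover have "(a * e - b * c) * coeff P d
          = e * (a * coeff P d + b * coeff Q d) - b * (c * coeff P d + e * coeff Q d)"
        "(a * e - b * c) * coeff Q d
          = a * (c * coeff P d + e * coeff Q d) - c * (a * coeff P d + b * coeff Q d)"
        by (simp_all add: algebra_simps)
      ultimately have "(a * e - b * c) * coeff P d = 0" "(a * e - b * c) * coeff Q d = 0"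
        by simp_all
      then show False using nz det by auto
    qed
    then have "d \<le> max (degree ?F) (degree ?G)"
      using le_degree[of ?F d] le_degree[of ?G d] by linarith
    moreover have "degree ?F \<le> d" "degree ?G \<le> d"
      by (auto simp: d_def intro!: degree_add_le intro: order.trans[OF degree_smult_le])
    ultimately have "max (degree ?F) (degree ?G) = d" by linarith
    then show ?thesis using None moebius_quotient[OF det nz] by (simp add: Let_def flip: d_def)
  next
    case (Some z)
    have "poly P z \<noteq> 0 \<or> poly Q z \<noteq> 0" using assms(1) coprime_poly_0 by blast
    from moebius_quotient[OF det this] show ?thesis using Some by simp
  qed
qed

lemma conj_poly_eq_imp_real:
  assumes "conj_poly F = F"
  obtains A where "F = map_poly complex_of_real A"
proof (rule that[of "map_poly Re F"], rule poly_eqI)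
  fix n
  have "cnj (coeff F n) = coeff F n" using arg_cong[OF assms, of "\<lambda>p. coeff p n"] by simp
  then show "coeff F n = coeff (map_poly complex_of_real (map_poly Re F)) n"
    by (simp add: coeff_map_poly complex_eq_iff)
qed

lemma map_poly_of_real_mult:
  "map_poly complex_of_real (p * q) = map_poly complex_of_real p * map_poly complex_of_real q"
  by (intro poly_eqI) (simp add: coeff_map_poly coeff_mult)

lemma real_rational_map_ratio_map:
  assumes "coprime F G" "G \<noteq> 0" "conj_poly F = F" "conj_poly G = G"
  shows "real_rational_map (ratio_map F G)"
proof -
  obtain A where A: "F = map_poly complex_of_real A" using conj_poly_eq_imp_real[OF assms(3)] .
  obtain B where B: "G = map_poly complex_of_real B" using conj_poly_eq_imp_real[OF assms(4)] .
  have "B \<noteq> 0" using B assms(2) by auto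
  have "coprime A B"
  proof (rule coprimeI)
    fix D assume D: "D dvd A" "D dvd B"
    have "map_poly complex_of_real D dvd F" "map_poly complex_of_real D dvd G"
      using D unfolding A B by (auto simp: dvd_def map_poly_of_real_mult)
    then have "is_unit (map_poly complex_of_real D)"
      using assms(1) coprime_common_divisor by blast
    then have "degree (map_poly complex_of_real D) = 0" by (metis is_unit_iff_degree not_is_unit_0)
    then have "degree D = 0" by (simp add: degree_map_poly)
    moreover have "D \<noteq> 0" using D \<open>B \<noteq> 0\<close> by auto
    ultimately show "is_unit D" by (simp add: is_unit_iff_degree)
  qed
  then show ?thesis unfolding real_rational_map_def using A B \<open>B \<noteq> 0\<close> by blast
qed

text \<open>Inverting the linear system recovers \<open>P\<close> and \<open>Q\<close> up to the
  determinant, so common divisors are shared.\<close>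

lemma coprime_combination:
  fixes P Q :: "complex poly"
  assumes "coprime P Q" "a * e - b * c \<noteq> 0"
  shows "coprime (smult a P + smult b Q) (smult c P + smult e Q)" (is "coprime ?F ?G")
proof (rule coprimeI)
  fix D assume D: "D dvd ?F" "D dvd ?G"
  have "smult (a * e - b * c) P = smult e ?F - smult b ?G"
    "smult (a * e - b * c) Q = smult a ?G - smult c ?F"
    by (simp_all add: smult_add_right smult_diff_left mult.commute)
  then have "D dvd smult (a * e - b * c) P" "D dvd smult (a * e - b * c) Q"
    using D by (simp_all add: dvd_diff dvd_smult)
  then have "D dvd P" "D dvd Q" using assms(2) dvd_smult_cancel by blast+
  then show "is_unit D" using assms(1) coprime_common_divisor by blast
qed

text \<open>\<open>F\<close> is treated as a form of degree \<open>d\<close>: a vanishing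
  coefficient at \<open>d\<close> is a root at infinity.\<close>

fun sphere_eval :: "nat \<Rightarrow> sphere \<Rightarrow> complex poly \<Rightarrow> complex" where
  "sphere_eval d (Some z) F = poly F z"
| "sphere_eval d None F = coeff F d"

text \<open>The coordinate \<open>u\<close> with \<open>z = p + 1 / u\<close>. At
  \<open>Some p\<close> it would be infinite; the default 0 is excluded wherever it is used.\<close>

fun recentered_point :: "complex \<Rightarrow> sphere \<Rightarrow> complex" where
  "recentered_point p (Some z) = 1 / (z - p)"
| "recentered_point p None = 0"

lemma poly_recenter_eq_0_iff:
  assumes "degree F \<le> d" "x \<noteq> Some p"
  shows "poly (recenter d p F) (recentered_point p x) = 0 \<longleftrightarrow> sphere_eval d x F = 0"
  using assms by (cases x) (auto simp: poly_recenter poly_recenter_0)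

lemma inj_on_recentered_point: "inj_on (recentered_point p) (- {Some p})"
proof (rule inj_onI)
  fix x y assume "x \<in> - {Some p}" "y \<in> - {Some p}" "recentered_point p x = recentered_point p y"
  then show "x = y" by (cases x; cases y) auto
qed

lemma sphere_eval_wronskian_critical:
  assumes "coprime P Q" "Q \<noteq> 0" "d = max (degree P) (degree Q)" "x \<in> critical_points (ratio_map P Q)"
  shows "sphere_eval (2 * d - 2) x (wronskian P Q) = 0"
  using assms wronskian_eq_0_at_finite_critical_point coeff_wronskian_eq_0_at_infinite_critical_point
  by (cases x) auto

section \<open>Choice of the real base point and assembly of the proof\<close>

theorem theorem18:
  fixes R :: "sphere \<Rightarrow> sphere" and d :: nat
  assumes "generic_rational_map d R"
    and "critical_points R \<subseteq> real_circle"
  shows "\<exists>\<sigma>. moebius \<sigma> \<and> real_rational_map (\<sigma> \<circ> R)"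
proof -
  define K where "K = critical_points R"
  obtain P Q where PQ: "Q \<noteq> 0" "coprime P Q" and d: "d = max (degree P) (degree Q)"
    and R: "R = ratio_map P Q"
    using assms(1) by (auto simp: generic_rational_map_def rational_map_def)
  have K: "finite K" "int (card K) = 2 * int d - 2" "K \<subseteq> real_circle"
    using assms by (auto simp: generic_rational_map_def K_def)
  then have d1: "d \<ge> 1" by linarith
  have cardK: "card K = 2 * (d - 1)" using K(2) d1 by linarith
  have deg: "degree P \<le> d" "degree Q \<le> d" using d by auto
  define w where "w = wronskian P Q"
  have w0: "w \<noteq> 0" unfolding w_def using PQ d d1 by (intro wronskian_nonzero) auto
  have deg_w: "degree w \<le> 2 * d - 2" unfolding w_def using deg by (intro wronskian_flip_poly(1))
  have wK: "sphere_eval (2 * d - 2) x w = 0" if "x \<in> K" for x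
    using that PQ d unfolding w_def K_def R by (intro sphere_eval_wronskian_critical)

  \<comment> \<open>A finite point \<open>u\<close> is a root of \<open>f x\<close> exactly when
    \<open>R\<close> takes the same value at \<open>u\<close> and at \<open>x\<close>.\<close>
  define f where "f x = smult (sphere_eval d x P) Q - smult (sphere_eval d x Q) P" for x
  have f0: "f x \<noteq> 0" for x
  proof
    assume "f x = 0"
    then have eq: "smult (sphere_eval d x P) Q = smult (sphere_eval d x Q) P" by (simp add: f_def)
    have "smult (sphere_eval d x P) (wronskian P Q) = 0"
      using arg_cong[OF eq, of "wronskian P"] by (simp add: wronskian_smult_right)
    moreover have "smult (sphere_eval d x Q) (wronskian P Q) = 0"
      using arg_cong[OF eq, of "\<lambda>r. wronskian r Q"] by (simp add: wronskian_smult_left)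
    ultimately have z: "sphere_eval d x P = 0" "sphere_eval d x Q = 0" using w0 by (auto simp: w_def)
    show False
    proof (cases x)
      case None
      then show ?thesis using z coprime_top_coeff[OF PQ(2,1) d] by simp
    next
      case (Some u)
      then show ?thesis using z coprime_poly_0[OF PQ(2), of u] by simp
    qed
  qed
  \<comment> \<open>A real \<open>p\<close> outside this finite set is not critical, and its value
    under \<open>R\<close> is not a critical value.\<close>
  define bad where "bad = {u. poly w u = 0} \<union> (\<Union>x\<in>K. {u. poly (f x) u = 0})"
  have "finite bad"
    unfolding bad_def using w0 f0 K(1) by (auto simp: poly_roots_finite)
  moreover have "infinite (\<real> :: complex set)"
    unfolding Reals_def by (simp add: finite_image_iff inj_on_def infinite_UNIV_char_0)
  ultimately have "\<not> \<real> \<subseteq> bad" using finite_subset by blast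
  then obtain p where "p \<in> \<real>" "p \<notin> bad" by blast
  then have p: "p \<in> \<real>" "poly w p \<noteq> 0" "\<And>x. x \<in> K \<Longrightarrow> poly (f x) p \<noteq> 0"
    by (auto simp: bad_def)

  have pK: "x \<noteq> Some p" if "x \<in> K" for x using wK[OF that] p(2) by auto
  define T where "T = recenter d p"
  \<comment> \<open>\<open>y\<close> spans the elements of the span vanishing at \<open>p\<close>;
    \<open>b\<close> is whichever of \<open>P\<close> and \<open>Q\<close> is nonzero at
    \<open>p\<close>, so the two form a basis.\<close>
  define \<alpha> where "\<alpha> = (if poly P p \<noteq> 0 then 1 else 0 :: complex)"
  define \<beta> where "\<beta> = (if poly P p \<noteq> 0 then 0 else 1 :: complex)"
  define y where "y = smult (poly Q p) P + smult (- poly P p) Q"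
  define b where "b = smult \<alpha> P + smult \<beta> Q"
  have deg_comb: "degree (smult \<mu> P + smult \<nu> Q) \<le> d" for \<mu> \<nu>
    using deg by (intro degree_add_le order.trans[OF degree_smult_le])
  have deg_yb: "degree y \<le> d" "degree b \<le> d"
    unfolding y_def b_def by (rule deg_comb)+
  define X where "X = recentered_point p ` K"
  have X: "finite X" "X \<subseteq> \<real>" "card X = 2 * (d - 1)"
  proof -
    show "finite X" using K(1) by (simp add: X_def)
    have "recentered_point p x \<in> \<real>" if "x \<in> K" for x
      using that K(3) p(1) by (cases x) (auto simp: real_circle_def)
    then show "X \<subseteq> \<real>" by (auto simp: X_def)
    have "inj_on (recentered_point p) K"
      using pK by (intro inj_on_subset[OF inj_on_recentered_point]) auto
    then show "card X = 2 * (d - 1)" using cardK by (simp add: X_def card_image)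
  qed
  have "- (\<alpha> * poly P p + \<beta> * poly Q p) \<noteq> 0"
    using coprime_poly_0[OF PQ(2), of p] by (auto simp: \<alpha>_def \<beta>_def)
  then obtain \<gamma> where \<gamma>: "\<gamma> \<noteq> 0" "wronskian b y = smult \<gamma> w"
    unfolding b_def y_def w_def wronskian_combination
    by (metis add_uminus_conv_diff minus_add_distrib mult_minus_right)
  have Tw: "wronskian (T b) (T y) = smult (- \<gamma>) (recenter (2 * d - 2) p w)"
    unfolding T_def using deg_yb by (simp add: wronskian_recenter \<gamma>(2) recenter_smult)
  obtain s t r where str: "s \<noteq> 0" "r \<noteq> 0" "conj_poly (smult s (T y)) = smult s (T y)"
    "conj_poly (smult r (T b) + smult t (T y)) = smult r (T b) + smult t (T y)"
  proof (rule real_basis[OF X])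
    \<comment> \<open>The coefficient at \<open>d\<close> after recentering is the value at
      \<open>p\<close>, which is 0 for \<open>y\<close>.\<close>
    show "degree (T y) \<le> d - 1"
    proof (rule degree_le, intro allI impI)
      fix n assume n: "d - 1 < n"
      show "coeff (T y) n = 0"
      proof (cases "n = d")
        case True
        then show ?thesis by (simp add: T_def coeff_recenter_top y_def)
      next
        case False
        then have "n > d" using n by linarith
        then show ?thesis by (simp add: T_def recenter_def coeff_flip_poly)
      qed
    qed
    show "degree (T b) \<le> d - 1 + 1"
      using d1 degree_flip_poly_le[of d] by (simp add: T_def recenter_def)
    show "poly (T y) u \<noteq> 0" if "u \<in> X" for u
    proof -
      obtain x where x: "x \<in> K" "u = recentered_point p x" using \<open>u \<in> X\<close> by (auto simp: X_def)
      have "sphere_eval d x y = poly (f x) p"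
        by (cases x) (simp_all add: y_def f_def)
      then show ?thesis
        using poly_recenter_eq_0_iff[OF deg_yb(1) pK[OF x(1)]] p(3)[OF x(1)] by (simp add: T_def x(2))
    qed
    have "recenter (2 * d - 2) p w \<noteq> 0" using recenter_eq_0 deg_w w0 by blast
    then show "wronskian (T b) (T y) \<noteq> 0" using \<gamma>(1) by (simp add: Tw)
    show "poly (wronskian (T b) (T y)) u = 0" if "u \<in> X" for u
    proof -
      obtain x where x: "x \<in> K" "u = recentered_point p x" using \<open>u \<in> X\<close> by (auto simp: X_def)
      show ?thesis
        using poly_recenter_eq_0_iff[OF deg_w pK[OF x(1)]] wK[OF x(1)] by (simp add: Tw x(2))
    qed
  qed

  \<comment> \<open>\<open>T\<close> is linear, so the same combinations before recentering give a
    real basis of the span of \<open>P\<close> and \<open>Q\<close>; its coefficients form the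
    Moebius map.\<close>
  define F where "F = smult s y"
  define G where "G = smult r b + smult t y"
  obtain A B C E where F: "F = smult A P + smult B Q" and G: "G = smult C P + smult E Q"
  proof
    show "F = smult (s * poly Q p) P + smult (s * - poly P p) Q"
      by (simp add: F_def y_def smult_diff_right)
    show "G = smult (r * \<alpha> + t * poly Q p) P + smult (r * \<beta> + t * - poly P p) Q"
      by (simp add: G_def b_def y_def smult_add_right smult_add_left smult_diff_right smult_diff_left
          algebra_simps)
  qed
  have cF: "conj_poly F = F"
  proof (rule conj_poly_eq_of_recenter[OF p(1)])
    show "degree F \<le> d" unfolding F by (rule deg_comb)
    have "recenter d p F = smult s (T y)" by (simp only: F_def T_def recenter_smult)
    with str(3) show "conj_poly (recenter d p F) = recenter d p F" by (simp only:)
  qed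
  have cG: "conj_poly G = G"
  proof (rule conj_poly_eq_of_recenter[OF p(1)])
    show "degree G \<le> d" unfolding G by (rule deg_comb)
    have "recenter d p G = smult r (T b) + smult t (T y)"
      by (simp only: G_def T_def recenter_smult recenter_add)
    with str(4) show "conj_poly (recenter d p G) = recenter d p G" by (simp only:)
  qed
  have "wronskian G F = smult (r * s * \<gamma>) w"
    by (simp add: G_def F_def wronskian_add_left wronskian_smult_left wronskian_smult_right \<gamma>(2) mult_ac)
  then have wGF: "wronskian G F \<noteq> 0" using str(1,2) \<gamma>(1) w0 by simp
  then have "G \<noteq> 0" by auto
  from wGF have det: "A * E - B * C \<noteq> 0"
    unfolding F G wronskian_combination by (auto simp: mult.commute)
  have "coprime F G" unfolding F G using PQ(2) det by (rule coprime_combination)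
  then have "real_rational_map (ratio_map F G)"
    using \<open>G \<noteq> 0\<close> cF cG by (intro real_rational_map_ratio_map)
  then have "real_rational_map (ratio_map [:B, A:] [:E, C:] \<circ> R)"
    unfolding R moebius_comp_ratio_map[OF PQ(2,1) det] F G .
  moreover have "moebius (ratio_map [:B, A:] [:E, C:])"
    unfolding moebius_def using det by blast
  ultimately show ?thesis by blast
qed

end
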